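(* Consider the stochastic volatility model $X_t=\sigma_t\,Z_t$, $t\in\mathbb{Z}$, where $(Z_t)$ is an iid sequence of real-valued random variables with generic element $Z$, which is regularly varying with index $\alpha=2$, centered ($\mathbb{E}[Z]=0$) and has infinite variance, and where $(Z_t)$ is independent of the log-volatility sequence $$\log\sigma_t=\sum_{j=0}^\infty\psi_j\,\eta_{t-j},\qquad t\in\mathbb{Z},$$ where $(\psi_j)_{j\ge 0}$ is a square-integrable (i.e. $\sum_j\psi_j^2<\infty$) sequence of real numbers and $(\eta_t)_{t\in\mathbb{Z}}$ is iid standard normal. Let $S_n=X_1+\cdots+X_n$ and let $(a_n^Z)$ be defined by $$n\,\mathbb{P}(|Z|>a_n^Z)+\frac{n}{(a_n^Z)^2}\,\mathbb{E}\big[Z^2\,\mathbf 1(|Z|\le a_n^Z)\big]=1 .$$ Then $$(a_n^Z)^{-1}S_n\ \stackrel{d}{\to}\ N\Big(0,\exp\Big(2\sum_{j=0}^\infty\psi_j^2\Big)\Big),\qquad n\to\infty .$$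
   Context: An iid sequence with generic element $Z$ is regularly varying with index $\alpha=2$ if there exist a slowly varying function $L$ and constants $p_\pm\ge 0$ such that $\mathbb{P}(|Z|>x)=L(x)x^{-2}$ for $x>0$ and $\mathbb{P}(\pm Z>x)/\mathbb{P}(|Z|>x)\to p_\pm$ as $x\to\infty$. The sequence $(a_n^Z)$ (the normalizing sequence in the central limit theorem for the iid sequence $(Z_t)$) is uniquely defined by its equation for all sufficiently large $n$. *)

theory Defs
  imports "HOL-Probability.Probability"
begin

definition slowly_varying :: "(real \<Rightarrow> real) \<Rightarrow> bool" where
  "slowly_varying L \<longleftrightarrow>
     set_borel_measurable borel {0<..} L \<and>
     (\<forall>\<^sub>F x in at_top. L x > 0) \<and>
     (\<forall>c>0. ((\<lambda>x. L (c * x) / L x) \<longlongrightarrow> 1) at_top)"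

definition regularly_varying :: "'a measure \<Rightarrow> ('a \<Rightarrow> real) \<Rightarrow> real \<Rightarrow> bool" where
  "regularly_varying M Z \<alpha> \<longleftrightarrow>
     (\<exists>L pp pm. slowly_varying L \<and> pp \<ge> 0 \<and> pm \<ge> 0 \<and>
        (\<forall>x>0. \<P>(\<omega> in M. \<bar>Z \<omega>\<bar> > x) = L x * x powr (- \<alpha>)) \<and>
        ((\<lambda>x. \<P>(\<omega> in M. Z \<omega> > x) / \<P>(\<omega> in M. \<bar>Z \<omega>\<bar> > x)) \<longlongrightarrow> pp) at_top \<and>
        ((\<lambda>x. \<P>(\<omega> in M. - Z \<omega> > x) / \<P>(\<omega> in M. \<bar>Z \<omega>\<bar> > x)) \<longlongrightarrow> pm) at_top)"

definition iid :: "'a measure \<Rightarrow> ('i \<Rightarrow> 'a \<Rightarrow> real) \<Rightarrow> bool" where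
  "iid M X \<longleftrightarrow> prob_space.indep_vars M (\<lambda>_. borel) X UNIV \<and>
     (\<forall>s t. distr M borel (X s) = distr M borel (X t))"

text \<open>
  If \<open>\<psi>\<close> is square summable and \<open>\<eta>\<close> is iid standard normal, the series converges almost surely.
  On the exceptional null set \<open>suminf\<close> takes an unspecified value.
\<close>
definition log_volatility :: "(nat \<Rightarrow> real) \<Rightarrow> (int \<Rightarrow> 'a \<Rightarrow> real) \<Rightarrow> int \<Rightarrow> 'a \<Rightarrow> real" where
  "log_volatility \<psi> \<eta> t \<omega> = (\<Sum>j. \<psi> j * \<eta> (t - int j) \<omega>)"

definition sv_process ::
  "(nat \<Rightarrow> real) \<Rightarrow> (int \<Rightarrow> 'a \<Rightarrow> real) \<Rightarrow> (int \<Rightarrow> 'a \<Rightarrow> real) \<Rightarrow> int \<Rightarrow> 'a \<Rightarrow> real" where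
  "sv_process \<psi> \<eta> Z t \<omega> = exp (log_volatility \<psi> \<eta> t \<omega>) * Z t \<omega>"

text \<open>The defining equation determines the normalizing sequence only for large \<open>n\<close>.\<close>
definition normalizing_sequence :: "'a measure \<Rightarrow> ('a \<Rightarrow> real) \<Rightarrow> (nat \<Rightarrow> real) \<Rightarrow> bool" where
  "normalizing_sequence M Z a \<longleftrightarrow>
     (\<forall>\<^sub>F n in sequentially. a n > 0 \<and>
        real n * \<P>(\<omega> in M. \<bar>Z \<omega>\<bar> > a n)
        + real n / (a n)\<^sup>2 * (\<integral>\<omega>. (Z \<omega>)\<^sup>2 * indicator {\<omega>. \<bar>Z \<omega>\<bar> \<le> a n} \<omega> \<partial>M) = 1)"

end

theory Submission imports Defs begin

text \<open>
  Let \<open>\<phi>\<close> be the characteristic function of \<open>Z\<close>. Given the volatilities \<open>\<sigma>\<^sub>t\<close>, the normalized sum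
  \<open>S\<^sub>n/a\<^sub>n\<close> is a sum of independent variables, so that its characteristic function at \<open>u\<close> is the expectation
  of the product of the factors \<open>\<phi>(u \<sigma>\<^sub>t/a\<^sub>n)\<close> over \<open>t \<le> n\<close> (\<open>expectation_iexp_random_weights\<close>).

  Put \<open>H(s) = E[min (s Z)\<^sup>2 1]\<close>. Since the tail of \<open>Z\<close> varies regularly with index \<open>-2\<close>, the probability
  \<open>P(|s Z| > 1)\<close> is of smaller order than \<open>H(s)\<close> as \<open>s \<rightarrow> 0\<close> (\<open>tail_negligible\<close>). Two things follow:
  \<open>H(c s)/H(s) \<rightarrow> c\<^sup>2\<close> (\<open>H_regular\<close>) and, as \<open>Z\<close> is centred, \<open>\<phi>(s) = 1 - H(s)/2 + o(H(s))\<close>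
  (\<open>char_expansion\<close>). The normalizing equation says precisely that \<open>n H(1/a\<^sub>n) = 1\<close>. The product is therefore
  close to the exponential of \<open>-1/2\<close> times the sum of the \<open>H(u \<sigma>\<^sub>t/a\<^sub>n)\<close>, and this sum is close to \<open>u\<^sup>2\<close>
  times the average of \<open>\<sigma>\<^sub>1\<^sup>2, \<dots>, \<sigma>\<^sub>n\<^sup>2\<close>. All errors are measured in \<open>L\<^sup>1\<close>; because
  \<open>H(c s) \<le> max c\<^sup>2 1 * H(s)\<close> for all \<open>c\<close> and \<open>s\<close>, dominated convergence applies as soon as \<open>\<sigma>\<^sub>0\<close> has a second
  moment (\<open>expected_char_product_limit\<close>).

  It remains to show that the average of the \<open>\<sigma>\<^sub>t\<^sup>2\<close> tends to \<open>exp (2 \<Sum> \<psi>\<^sub>j\<^sup>2)\<close> in \<open>L\<^sup>1\<close>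
  (\<open>squared_volatility_weak_law\<close>). The series for \<open>log \<sigma>\<^sub>t\<close> converges almost surely by Kolmogorov's
  maximal inequality (\<open>AE_summable\<close>). Cut off after \<open>m\<close> terms, it gives log-normal variables that are
  uncorrelated at distance \<open>m\<close>, for which the law of large numbers is a variance bound, and explicit
  log-normal moments show that the cut-off is harmless in \<open>L\<^sup>2\<close>. Levy's continuity theorem concludes.
\<close>

section \<open>Distributions with a regularly varying tail of index 2\<close>

text \<open>
  With \<open>V x = E[min(Z\<^sup>2, x\<^sup>2)]\<close>, the usual truncated second moment, this is \<open>s\<^sup>2 V(1/s)\<close>.
  Using the reciprocal \<open>s\<close> of the truncation level moves all asymptotics to \<open>s \<rightarrow> 0\<close>, where the
  characteristic function is expanded, and turns the normalizing equation into \<open>n H(1/a\<^sub>n) = 1\<close>.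
\<close>

definition truncated_second_moment :: "real measure \<Rightarrow> real \<Rightarrow> real" where
  "truncated_second_moment \<mu> s = (\<integral>y. min ((s * y)\<^sup>2) 1 \<partial>\<mu>)"

definition scaled_tail :: "real measure \<Rightarrow> real \<Rightarrow> real" where
  "scaled_tail \<mu> s = measure \<mu> {y. 1 < \<bar>s * y\<bar>}"

definition scaled_tail_moment :: "real measure \<Rightarrow> real \<Rightarrow> real" where
  "scaled_tail_moment \<mu> s = (\<integral>y. \<bar>s * y\<bar> * indicator {y. 1 < \<bar>s * y\<bar>} y \<partial>\<mu>)"

text \<open>
  The centred laws whose two-sided tail \<open>P(|Z| > x)\<close> is regularly varying with index \<open>-2\<close>, the condition
  being written at \<open>s = 1/x\<close>.
\<close>

locale square_tail_distribution = real_distribution \<mu> for \<mu> :: "real measure" +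
  assumes tail_regular: "c \<noteq> 0 \<Longrightarrow> ((\<lambda>s. scaled_tail \<mu> (c * s) / scaled_tail \<mu> s) \<longlongrightarrow> c\<^sup>2) (at 0)"
    and tail_pos: "\<forall>\<^sub>F s in at 0. 0 < scaled_tail \<mu> s"
    and integrable_id: "integrable \<mu> (\<lambda>y. y)"
    and mean_zero: "(\<integral>y. y \<partial>\<mu>) = 0"
begin

abbreviation "H \<equiv> truncated_second_moment \<mu>"
abbreviation "q \<equiv> scaled_tail \<mu>"
abbreviation "T \<equiv> scaled_tail_moment \<mu>"

lemma prob_UNIV [simp]: "measure \<mu> UNIV = 1"
  using prob_space by simp

lemma integrable_bounded:
  fixes f :: "real \<Rightarrow> 'b::{banach, second_countable_topology}"
  assumes [measurable]: "f \<in> borel_measurable borel" and "\<And>y. norm (f y) \<le> B"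
  shows "integrable \<mu> f"
  by (rule integrable_const_bound[where B=B]) (use assms in auto)

lemma integrable_truncated [simp]: "integrable \<mu> (\<lambda>y. min ((s * y)\<^sup>2) 1)"
  by (rule integrable_bounded[where B=1]) auto

lemma integrable_tail_indicator [simp]:
  "integrable \<mu> (\<lambda>y. indicator {y. 1 < \<bar>s * y\<bar>} y :: real)"
  by (rule integrable_bounded[where B=1]) (auto simp: indicator_def)

lemma q_eq_integral: "q s = (\<integral>y. indicator {y. 1 < \<bar>s * y\<bar>} y \<partial>\<mu>)"
  by (simp add: scaled_tail_def)

lemma q_nonneg [simp]: "0 \<le> q s" and H_nonneg [simp]: "0 \<le> H s" and T_nonneg [simp]: "0 \<le> T s"
  and H_zero [simp]: "H 0 = 0"
  by (auto simp: scaled_tail_def truncated_second_moment_def scaled_tail_moment_def)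

lemma H_le_1: "H s \<le> 1"
proof -
  have "H s \<le> (\<integral>y. 1 \<partial>\<mu>)" unfolding truncated_second_moment_def
    by (intro integral_mono) auto
  then show ?thesis by simp
qed

lemma q_le_H: "q s \<le> H s"
  unfolding q_eq_integral truncated_second_moment_def
proof (intro integral_mono)
  show "indicator {y. 1 < \<bar>s * y\<bar>} y \<le> min ((s * y)\<^sup>2) (1::real)" for y
    using abs_le_square_iff[of 1 "s * y"] by (auto simp: indicator_def)
qed auto

lemma H_mono: assumes "\<bar>s\<bar> \<le> \<bar>t\<bar>" shows "H s \<le> H t"
  unfolding truncated_second_moment_def
proof (intro integral_mono)
  fix y
  have "(s * y)\<^sup>2 \<le> (t * y)\<^sup>2"
    using assms by (simp add: power_mult_distrib abs_le_square_iff mult_right_mono)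
  then show "min ((s * y)\<^sup>2) (1::real) \<le> min ((t * y)\<^sup>2) 1" by auto
qed auto

text \<open>
  Crude as it is, this bound holds for all \<open>s\<close> at once. It is what dominates the ratios \<open>H(cs)/H(s)\<close>
  when \<open>c\<close> is random, at the price of no more than a second moment of \<open>c\<close>.
\<close>

lemma H_scale_le: "H (c * s) \<le> max (c\<^sup>2) 1 * H s"
proof -
  have "H (c * s) \<le> (\<integral>y. max (c\<^sup>2) 1 * min ((s * y)\<^sup>2) 1 \<partial>\<mu>)"
    unfolding truncated_second_moment_def
  proof (intro integral_mono)
    fix y
    show "min ((c * s * y)\<^sup>2) 1 \<le> max (c\<^sup>2) 1 * min ((s * y)\<^sup>2) 1"
    proof (cases "(s * y)\<^sup>2 \<le> 1")
      case True
      then show ?thesis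
        using mult_right_mono[of "c\<^sup>2" "max (c\<^sup>2) 1" "(s*y)\<^sup>2"]
        by (simp add: power_mult_distrib min_def mult.assoc)
    qed (auto simp: min_def)
  qed auto
  then show ?thesis by (simp add: truncated_second_moment_def)
qed

text \<open>
  With \<open>w = (s y)\<^sup>2\<close>, the two integrands \<open>min (c\<^sup>2 w) 1\<close> and \<open>c\<^sup>2 min w 1\<close> coincide unless one of the
  two truncations is active, and these events have probabilities \<open>q (c s)\<close> and \<open>q s\<close>.
\<close>

lemma H_scale_diff_le: "\<bar>H (c * s) - c\<^sup>2 * H s\<bar> \<le> (1 + c\<^sup>2) * (q s + q (c * s))"
proof -
  let ?f = "\<lambda>y. min ((c * s * y)\<^sup>2) 1 - c\<^sup>2 * min ((s * y)\<^sup>2) 1"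
  let ?g = "\<lambda>y. (1 + c\<^sup>2) * (indicator {y. 1 < \<bar>s * y\<bar>} y + indicator {y. 1 < \<bar>c * s * y\<bar>} y)"
  have "\<bar>?f y\<bar> \<le> ?g y" for y
  proof -
    define w where "w = (s * y)\<^sup>2"
    have w: "0 \<le> w" "(c * s * y)\<^sup>2 = c\<^sup>2 * w" by (auto simp: w_def power_mult_distrib)
    have i1: "indicator {y. 1 < \<bar>s * y\<bar>} y = (if 1 < w then 1 else 0 :: real)"
      using abs_square_le_1[of "s * y"] by (auto simp: w_def indicator_def)
    have i2: "indicator {y. 1 < \<bar>c * s * y\<bar>} y = (if 1 < c\<^sup>2 * w then 1 else 0 :: real)"
      using abs_square_le_1[of "c * s * y"] by (auto simp: w(2)[symmetric] indicator_def)
    have cw: "0 \<le> c\<^sup>2 * w" "w \<le> 1 \<Longrightarrow> c\<^sup>2 * w \<le> c\<^sup>2" using w by (auto intro: mult_left_le)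
    define a b where "a = c\<^sup>2 * w" and "b = c\<^sup>2"
    have "0 \<le> a" "0 \<le> b" "w \<le> 1 \<Longrightarrow> a \<le> b" using cw by (auto simp: a_def b_def)
    then have "\<bar>min a 1 - b * min w 1\<bar> \<le> (1 + b) * ((if 1 < w then 1 else 0) + (if 1 < a then 1 else 0))"
      if "w \<le> 1 \<Longrightarrow> b * w = a" using that by (cases "w \<le> 1"; cases "a \<le> 1") (auto simp: abs_le_iff)
    then show ?thesis unfolding i1 i2 w(2) w_def[symmetric] by (auto simp: a_def b_def)
  qed
  then have "\<bar>\<integral>y. ?f y \<partial>\<mu>\<bar> \<le> (\<integral>y. ?g y \<partial>\<mu>)"
    by (intro order_trans[OF integral_abs_bound] integral_mono)
       (auto intro!: Bochner_Integration.integrable_add integrable_diff integrable_mult_right)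
  then show ?thesis by (simp add: truncated_second_moment_def q_eq_integral)
qed

text \<open>
  Pointwise \<open>min (4 w) 1 / 4 \<le> min w 1\<close>, with a gap of \<open>3/4\<close> once \<open>w > 1\<close>. Iterated, the inequality
  collects the tails at all dyadic levels.
\<close>

lemma H_recursion: "H s \<ge> H (2 * s) / 4 + 3/4 * q s"
proof -
  have "(\<integral>y. (1/4) * min ((2 * s * y)\<^sup>2) 1 + (3/4) * indicator {y. 1 < \<bar>s * y\<bar>} y \<partial>\<mu>) \<le> H s"
    unfolding truncated_second_moment_def
  proof (intro integral_mono)
    fix y
    define w where "w = (s * y)\<^sup>2"
    have w: "0 \<le> w" "(2 * s * y)\<^sup>2 = 4 * w" by (auto simp: w_def power_mult_distrib)
    have i1: "indicator {y. 1 < \<bar>s * y\<bar>} y = (if 1 < w then 1 else 0 :: real)"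
      using abs_square_le_1[of "s * y"] by (auto simp: w_def indicator_def)
    show "(1/4) * min ((2 * s * y)\<^sup>2) 1 + (3/4) * indicator {y. 1 < \<bar>s * y\<bar>} y \<le> min ((s * y)\<^sup>2) 1"
      unfolding i1 w(2) w_def[symmetric] using w(1) by (auto simp: min_def)
  qed auto
  then show ?thesis by (simp add: truncated_second_moment_def q_eq_integral)
qed

lemma H_ge_dyadic_sum: "(\<Sum>k<K. 3/4 * (q (2^k * s) / 4^k)) \<le> H s"
proof -
  have "(\<Sum>k<K. 3/4 * (q (2^k * s) / 4^k)) + H (2^K * s) / 4^K \<le> H s"
  proof (induction K)
    case (Suc K)
    have "(H (2 * (2^K * s)) / 4 + 3/4 * q (2^K * s)) / 4^K \<le> H (2^K * s) / 4^K"
      by (intro divide_right_mono H_recursion) auto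
    then show ?case using Suc by (simp add: add_divide_distrib mult.assoc)
  qed simp
  moreover have "0 \<le> H (2^K * s) / 4^K" by simp
  ultimately show ?thesis by linarith
qed

lemma H_pos: "0 < H s" if "s \<noteq> 0"
proof -
  obtain d where d: "d > 0" "\<And>t. t \<noteq> 0 \<Longrightarrow> \<bar>t\<bar> < d \<Longrightarrow> 0 < q t"
    using tail_pos by (auto simp: eventually_at dist_real_def)
  define t where "t = min (d/2) \<bar>s\<bar>"
  have "0 < q t" using d that by (intro d(2)) (auto simp: t_def)
  also have "\<dots> \<le> H t" by (rule q_le_H)
  also have "\<dots> \<le> H s" using d that by (intro H_mono) (auto simp: t_def)
  finally show ?thesis .
qed

text \<open>
  By regular variation of index 2 each of the \<open>K\<close> terms of the dyadic sum is asymptotic to \<open>3/4 q(s)\<close>,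
  so that \<open>H\<close> eventually exceeds every fixed multiple of \<open>q\<close>. This is Karamata's theorem in the
  borderline case, and the reason why the limit is Gaussian: large values of \<open>Z\<close> are negligible against
  the truncated second moment.
\<close>

lemma tail_negligible: "((\<lambda>s. q s / H s) \<longlongrightarrow> 0) (at 0)"
proof (rule tendstoI)
  fix e :: real assume e: "e > 0"
  obtain K :: nat where K: "real K > 2 / e" using reals_Archimedean2 by blast
  have K0: "K > 0" using K e by (cases K) (auto simp: field_simps)
  have "((\<lambda>s. \<Sum>k<K. 3/4 * ((q (2^k * s) / q s) / 4^k)) \<longlongrightarrow> (\<Sum>k<K. 3/4 * ((2^k)\<^sup>2 / 4^k))) (at 0)"
    by (intro tendsto_intros tail_regular) auto
  also have "(\<Sum>k<K. 3/4 * ((2^k)\<^sup>2 / 4^k)) = 3/4 * real K"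
    by (simp add: power_mult[symmetric] mult.commute[of _ 2] power_mult)
  finally have "((\<lambda>s. \<Sum>k<K. 3/4 * ((q (2^k * s) / q s) / 4^k)) \<longlongrightarrow> 3/4 * real K) (at 0)" .
  moreover have "real K / 2 < 3/4 * real K" using K0 by simp
  ultimately have "\<forall>\<^sub>F s in at 0. real K / 2 < (\<Sum>k<K. 3/4 * ((q (2^k * s) / q s) / 4^k))"
    by (rule order_tendstoD)
  then show "\<forall>\<^sub>F s in at 0. dist (q s / H s) 0 < e"
    using tail_pos
  proof eventually_elim
    case (elim s)
    have "real K / 2 * q s \<le> (\<Sum>k<K. 3/4 * ((q (2^k * s) / q s) / 4^k)) * q s"
      using elim by (intro mult_right_mono) auto
    also have "\<dots> = (\<Sum>k<K. 3/4 * (q (2^k * s) / 4^k))"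
      using elim by (simp add: sum_distrib_right)
    also have "\<dots> \<le> H s" by (rule H_ge_dyadic_sum)
    finally have *: "real K / 2 * q s \<le> H s" .
    have "0 < H s" using elim q_le_H[of s] by linarith
    have "1 < e * (real K / 2)" using K e by (simp add: field_simps)
    then have "1 * q s < e * (real K / 2) * q s" using elim by (intro mult_strict_right_mono) auto
    moreover have "e * (real K / 2 * q s) \<le> e * H s" using * e by (intro mult_left_mono) auto
    ultimately have "q s < e * H s" by (simp only: mult.assoc mult_1)
    then show ?case using \<open>0 < H s\<close> elim by (simp add: field_simps)
  qed
qed

lemma filterlim_scale_at_0: "c \<noteq> 0 \<Longrightarrow> filterlim (\<lambda>s. c * s) (at 0) (at (0::real))"
  by (auto simp: filterlim_at eventually_at intro!: tendsto_eq_intros exI[of _ 1])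

lemma tail_negligible_scaled:
  assumes c: "c \<noteq> 0" shows "((\<lambda>s. q (c * s) / H s) \<longlongrightarrow> 0) (at 0)"
proof (rule Lim_null_comparison)
  show "((\<lambda>s. max (c\<^sup>2) 1 * (q (c * s) / H (c * s))) \<longlongrightarrow> 0) (at 0)"
    using filterlim_compose[OF tail_negligible filterlim_scale_at_0[OF c]]
    by (intro tendsto_mult_right_zero) simp
  have "norm (q (c * s) / H s) \<le> max (c\<^sup>2) 1 * (q (c * s) / H (c * s))" if "s \<noteq> 0" for s
  proof -
    have "q (c * s) * H (c * s) \<le> q (c * s) * (max (c\<^sup>2) 1 * H s)"
      by (intro mult_left_mono H_scale_le) auto
    then show ?thesis using H_pos[of s] H_pos[of "c * s"] that c by (simp add: field_simps)
  qed
  then show "\<forall>\<^sub>F s in at 0. norm (q (c * s) / H s) \<le> max (c\<^sup>2) 1 * (q (c * s) / H (c * s))"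
    by (auto simp: eventually_at intro!: exI[of _ 1])
qed

text \<open>
  Equivalently, the truncated second moment \<open>V\<close> is slowly varying.
\<close>

lemma H_regular: "((\<lambda>s. H (c * s) / H s) \<longlongrightarrow> c\<^sup>2) (at 0)"
proof (cases "c = 0")
  case False
  have "((\<lambda>s. H (c * s) / H s - c\<^sup>2) \<longlongrightarrow> 0) (at 0)"
  proof (rule Lim_null_comparison)
    show "((\<lambda>s. (1 + c\<^sup>2) * (q (1 * s) / H s + q (c * s) / H s)) \<longlongrightarrow> 0) (at 0)"
      using tail_negligible_scaled[of 1] tail_negligible_scaled[OF False]
      by (intro tendsto_mult_right_zero tendsto_add_zero) auto
    have "norm (H (c * s) / H s - c\<^sup>2) \<le> (1 + c\<^sup>2) * (q (1 * s) / H s + q (c * s) / H s)" if "s \<noteq> 0" for s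
    proof -
      have "H (c * s) / H s - c\<^sup>2 = (H (c * s) - c\<^sup>2 * H s) / H s"
        using H_pos[OF that] by (simp add: field_simps)
      also have "norm \<dots> \<le> ((1 + c\<^sup>2) * (q s + q (c * s))) / H s"
        using H_pos[OF that] H_scale_diff_le[of c s] by (simp add: divide_right_mono)
      finally show ?thesis by (simp add: add_divide_distrib algebra_simps)
    qed
    then show "\<forall>\<^sub>F s in at 0. norm (H (c * s) / H s - c\<^sup>2) \<le> (1 + c\<^sup>2) * (q (1 * s) / H s + q (c * s) / H s)"
      by (auto simp: eventually_at intro!: exI[of _ 1])
  qed
  then show ?thesis by (simp add: LIM_zero_iff)
qed simp

lemma H_tendsto_0: "(H \<longlongrightarrow> 0) (at 0)"
  unfolding tendsto_at_iff_sequentially comp_def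
proof safe
  fix X :: "nat \<Rightarrow> real" assume X: "X \<longlonglongrightarrow> 0"
  have "(\<lambda>n. \<integral>y. min ((X n * y)\<^sup>2) 1 \<partial>\<mu>) \<longlonglongrightarrow> (\<integral>y. min ((0 * y)\<^sup>2) 1 \<partial>\<mu>)"
  proof (rule integral_dominated_convergence[where w="\<lambda>_. 1"])
    show "AE y in \<mu>. (\<lambda>n. min ((X n * y)\<^sup>2) 1) \<longlonglongrightarrow> min ((0 * y)\<^sup>2) 1"
      by (intro AE_I2 tendsto_intros X)
    show "AE y in \<mu>. norm (min ((X n * y)\<^sup>2) 1) \<le> 1" for n by (intro AE_I2) simp
  qed simp_all
  then have "(\<lambda>n. H (X n)) \<longlonglongrightarrow> H 0" by (simp only: truncated_second_moment_def)
  then show "(\<lambda>n. H (X n)) \<longlonglongrightarrow> 0" by (simp only: H_zero)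
qed

lemma integrable_tail_moment [simp]:
  "integrable \<mu> (\<lambda>y. \<bar>s * y\<bar> * indicator {y. 1 < \<bar>t * y\<bar>} y)"
proof -
  have "integrable \<mu> (\<lambda>y. indicator {y. 1 < \<bar>t * y\<bar>} y *\<^sub>R \<bar>s * y\<bar>)"
    by (intro integrable_mult_indicator integrable_abs integrable_mult_right integrable_id) simp
  then show ?thesis by (simp add: mult.commute)
qed

text \<open>
  The part with \<open>1 < |s y| \<le> 2\<close> is at most \<open>2 q(s)\<close>; on the rest, \<open>|s y| = 2 |s/2 y|\<close>.
\<close>

lemma T_recursion: "T s \<le> 2 * q s + 2 * T (s / 2)"
proof -
  have "T s \<le> (\<integral>y. 2 * indicator {y. 1 < \<bar>s * y\<bar>} y + 2 * (\<bar>s/2 * y\<bar> * indicator {y. 1 < \<bar>s/2 * y\<bar>} y) \<partial>\<mu>)"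
    unfolding scaled_tail_moment_def
  proof (intro integral_mono)
    show "\<bar>s * y\<bar> * indicator {y. 1 < \<bar>s * y\<bar>} y
      \<le> 2 * indicator {y. 1 < \<bar>s * y\<bar>} y + 2 * (\<bar>s/2 * y\<bar> * indicator {y. 1 < \<bar>s/2 * y\<bar>} y)" for y
      by (auto simp: indicator_def)
  qed (intro Bochner_Integration.integrable_add integrable_mult_right integrable_tail_moment
      integrable_tail_indicator)+
  also have "\<dots> = (\<integral>y. 2 * indicator {y. 1 < \<bar>s * y\<bar>} y \<partial>\<mu>)
      + (\<integral>y. 2 * (\<bar>s/2 * y\<bar> * indicator {y. 1 < \<bar>s/2 * y\<bar>} y) \<partial>\<mu>)"
    by (intro Bochner_Integration.integral_add integrable_mult_right integrable_tail_moment
        integrable_tail_indicator)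
  also have "\<dots> = 2 * q s + 2 * T (s / 2)"
    unfolding integral_mult_right_zero q_eq_integral scaled_tail_moment_def ..
  finally show ?thesis .
qed

lemma T_le_dyadic_sum: "T s \<le> (\<Sum>k<K. 2^(Suc k) * q (s / 2^k)) + 2^K * T (s / 2^K)"
proof (induction K)
  case (Suc K)
  have "2^K * T (s / 2^K) \<le> 2^K * (2 * q (s/2^K) + 2 * T (s / 2^K / 2))"
    by (intro mult_left_mono T_recursion) auto
  with Suc show ?case by (simp add: algebra_simps)
qed simp

lemma T_remainder: "(\<lambda>K. 2^K * T (s / 2^K)) \<longlonglongrightarrow> 0"
proof -
  have "(\<lambda>K. \<integral>y. \<bar>s * y\<bar> * indicator {y. 1 < \<bar>s / 2^K * y\<bar>} y \<partial>\<mu>) \<longlonglongrightarrow> (\<integral>y. 0 \<partial>\<mu>)"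
  proof (rule integral_dominated_convergence[where w="\<lambda>y. \<bar>s * y\<bar>"])
    show "integrable \<mu> (\<lambda>y. \<bar>s * y\<bar>)" using integrable_id by auto
    have "(\<lambda>K. \<bar>s * y\<bar> * indicator {y. 1 < \<bar>s / 2^K * y\<bar>} y) \<longlonglongrightarrow> 0" for y
    proof (rule tendsto_eventually)
      have "(\<lambda>K. \<bar>s * y\<bar> * (1/2)^K) \<longlonglongrightarrow> \<bar>s * y\<bar> * 0"
        by (intro tendsto_intros LIMSEQ_realpow_zero) auto
      then have "\<forall>\<^sub>F K in sequentially. \<bar>s * y\<bar> * (1/2)^K < 1" by (rule order_tendstoD) auto
      then show "\<forall>\<^sub>F K in sequentially. \<bar>s * y\<bar> * indicator {y. 1 < \<bar>s / 2^K * y\<bar>} y = 0"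
        by eventually_elim (auto simp: indicator_def abs_mult field_simps)
    qed
    then show "AE y in \<mu>. (\<lambda>K. \<bar>s * y\<bar> * indicator {y. 1 < \<bar>s / 2^K * y\<bar>} y) \<longlonglongrightarrow> 0" by simp
  qed (auto simp: indicator_def)
  moreover have "2^K * T (s / 2^K) = (\<integral>y. \<bar>s * y\<bar> * indicator {y. 1 < \<bar>s / 2^K * y\<bar>} y \<partial>\<mu>)" for K
    unfolding scaled_tail_moment_def integral_mult_right_zero[symmetric]
    by (intro Bochner_Integration.integral_cong) (auto simp: abs_mult)
  ultimately show ?thesis by simp
qed

text \<open>
  Near 0 regular variation gives \<open>q(s/2) \<le> q(s)/3\<close>. Any factor between \<open>1/4\<close> and \<open>1/2\<close> would make the
  dyadic series converge; for \<open>1/3\<close> its sum is \<open>6 q(s)\<close>.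
\<close>

lemma T_le_tail: "\<forall>\<^sub>F s in at 0. T s \<le> 6 * q s"
proof -
  have "\<forall>\<^sub>F s in at 0. q (1/2 * s) / q s < 1/3"
    using tail_regular[of "1/2"] by (rule order_tendstoD) (auto simp: power2_eq_square)
  with tail_pos have "\<forall>\<^sub>F s in at 0. q (s / 2) \<le> q s / 3"
    by eventually_elim (auto simp: field_simps)
  then obtain d where d: "d > 0" "\<And>s. s \<noteq> 0 \<Longrightarrow> \<bar>s\<bar> < d \<Longrightarrow> q (s / 2) \<le> q s / 3"
    by (auto simp: eventually_at dist_real_def)
  have "T s \<le> 6 * q s" if s: "s \<noteq> 0" "\<bar>s\<bar> < d" for s
  proof -
    have qk: "q (s / 2^k) \<le> q s / 3^k" for k
    proof (induction k)
      case (Suc k)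
      have "\<bar>s / 2^k\<bar> \<le> \<bar>s\<bar>" by (simp add: divide_le_eq mult_le_cancel_left1)
      then have "\<bar>s / 2^k\<bar> < d" using s by linarith
      then have "q (s / 2^k / 2) \<le> q (s / 2^k) / 3" using s by (intro d(2)) auto
      also have "\<dots> \<le> q s / 3^k / 3" using Suc by (intro divide_right_mono) auto
      finally show ?case by (simp add: mult.commute)
    qed simp
    have "T s \<le> 6 * q s + 2^K * T (s / 2^K)" for K
    proof -
      have "(\<Sum>k<K. 2^(Suc k) * q (s / 2^k)) \<le> (\<Sum>k<K. 2^(Suc k) * (q s / 3^k))"
        by (intro sum_mono mult_left_mono qk) auto
      also have "\<dots> = 2 * q s * (\<Sum>k<K. (2/3)^k)"
        by (simp add: sum_distrib_left power_divide mult_ac)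
      also have "\<dots> \<le> 2 * q s * 3"
        by (intro mult_left_mono) (auto simp: sum_gp_strict)
      finally show ?thesis using T_le_dyadic_sum[of s K] by linarith
    qed
    moreover have "(\<lambda>K. 6 * q s + 2^K * T (s / 2^K)) \<longlonglongrightarrow> 6 * q s + 0"
      by (intro tendsto_intros T_remainder)
    ultimately show ?thesis using LIMSEQ_le_const by fastforce
  qed
  then show ?thesis using d(1) by (auto simp: eventually_at dist_real_def)
qed

text \<open>
  The quadratic term of the Taylor expansion is truncated at 1, so that its integral is \<open>H/2\<close>. For
  \<open>|x| \<le> e\<close> the cubic remainder \<open>|x|\<^sup>3/6\<close> is small against \<open>x\<^sup>2\<close>, for \<open>e < |x| \<le> 1\<close> it is at most 1, and
  beyond 1 the first-order expansion suffices.
\<close>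

lemma iexp_truncated_bound:
  assumes e: "0 < e" "e \<le> 1"
  shows "cmod (iexp x - 1 - \<i> * x + min (x\<^sup>2) 1 / 2)
    \<le> e * min (x\<^sup>2) 1 + indicator {x. e < \<bar>x\<bar>} x + 3 * (\<bar>x\<bar> * indicator {x. 1 < \<bar>x\<bar>} x)"
proof (cases "\<bar>x\<bar> \<le> 1")
  case True
  then have m: "min (x\<^sup>2) 1 = x\<^sup>2" by (simp add: abs_square_le_1)
  have s2: "(\<Sum>k\<le>2. (\<i> * x)^k / fact k) = 1 + \<i> * x - x\<^sup>2 / 2"
    by (simp add: numeral_2_eq_2 power2_eq_square) (simp add: algebra_simps)
  have "cmod (iexp x - 1 - \<i> * x + min (x\<^sup>2) 1 / 2) = cmod (iexp x - (\<Sum>k\<le>2. (\<i> * x)^k / fact k))"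
    unfolding m s2 by (simp add: algebra_simps)
  also have "\<dots> \<le> \<bar>x\<bar>^3 / 6"
    using iexp_approx1[of x 2] by (simp add: numeral_3_eq_3 fact_numeral)
  also have "\<dots> \<le> e * x\<^sup>2 + indicator {x. e < \<bar>x\<bar>} x"
  proof (cases "\<bar>x\<bar> \<le> e")
    case True
    have "\<bar>x\<bar>^3 = \<bar>x\<bar> * x\<^sup>2" by (simp add: power3_eq_cube power2_eq_square)
    also have "\<dots> \<le> e * x\<^sup>2" using True by (intro mult_right_mono) auto
    moreover have "0 \<le> e * x\<^sup>2" using e by simp
    ultimately show ?thesis by (auto simp: indicator_def)
  next
    case False
    have "\<bar>x\<bar>^3 \<le> 1" using \<open>\<bar>x\<bar> \<le> 1\<close> by (simp add: power_le_one)
    then show ?thesis using False e by (auto simp: indicator_def add_increasing)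
  qed
  finally show ?thesis using m True by (simp add: indicator_def)
next
  case False
  then have "1 < x\<^sup>2" using abs_square_le_1[of x] by auto
  then have m: "min (x\<^sup>2) 1 = 1" by simp
  have "cmod (iexp x - 1 - \<i> * x) \<le> 2 * \<bar>x\<bar>"
    using iexp_approx2[of x 1] by (simp add: algebra_simps)
  moreover have "cmod (iexp x - 1 - \<i> * x + 1/2) \<le> cmod (iexp x - 1 - \<i> * x) + cmod (1/2)"
    by (rule norm_triangle_ineq)
  ultimately have "cmod (iexp x - 1 - \<i> * x + 1/2) \<le> 3 * \<bar>x\<bar>" using False by simp
  then show ?thesis unfolding m using False e by (auto simp: indicator_def)
qed

lemma char_expansion_bound:
  assumes e: "0 < e" "e \<le> 1"
  shows "cmod (char \<mu> s - 1 + H s / 2) \<le> e * H s + q (inverse e * s) + 3 * T s"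
proof -
  have int1: "integrable \<mu> (\<lambda>y. iexp (s * y))" by (rule integrable_iexp) auto
  have int2: "integrable \<mu> (\<lambda>y. \<i> * complex_of_real (s * y))" 
    using integrable_id by (intro integrable_mult_right integrable_of_real) auto
  have int3: "integrable \<mu> (\<lambda>y. complex_of_real (min ((s * y)\<^sup>2) 1) / 2)"
    using integrable_truncated[of s] by (intro integrable_divide integrable_of_real)
  have iA: "integrable \<mu> (\<lambda>y. e * min ((s * y)\<^sup>2) 1)"
    by (rule integrable_mult_right) (rule integrable_truncated)
  have iB: "integrable \<mu> (\<lambda>y. indicator {y. 1 < \<bar>inverse e * s * y\<bar>} y :: real)"
    by (rule integrable_tail_indicator)
  have iC: "integrable \<mu> (\<lambda>y. 3 * (\<bar>s * y\<bar> * indicator {y. 1 < \<bar>s * y\<bar>} y))"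
    by (rule integrable_mult_right) (rule integrable_tail_moment)
  have eq: "char \<mu> s - 1 + H s / 2 = (\<integral>y. iexp (s * y) - 1 - \<i> * complex_of_real (s * y) + complex_of_real (min ((s * y)\<^sup>2) 1) / 2 \<partial>\<mu>)"
    using int1 int2 int3 
    by (simp add: char_def truncated_second_moment_def mean_zero)
  have "cmod (char \<mu> s - 1 + H s / 2) \<le> (\<integral>y. e * min ((s * y)\<^sup>2) 1 + indicator {y. 1 < \<bar>inverse e * s * y\<bar>} y
      + 3 * (\<bar>s * y\<bar> * indicator {y. 1 < \<bar>s * y\<bar>} y) \<partial>\<mu>)"
    unfolding eq
  proof (intro order_trans[OF integral_norm_bound] integral_mono)
    fix y
    have "indicator {x. e < \<bar>x\<bar>} (s * y) = (indicator {y. 1 < \<bar>inverse e * s * y\<bar>} y :: real)"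
      using e by (auto simp: indicator_def abs_mult field_simps)
    moreover have "indicator {x. 1 < \<bar>x\<bar>} (s * y) = (indicator {y. 1 < \<bar>s * y\<bar>} y :: real)"
      by (auto simp: indicator_def)
    ultimately show "cmod (iexp (s * y) - 1 - \<i> * complex_of_real (s * y) + complex_of_real (min ((s * y)\<^sup>2) 1) / 2)
      \<le> e * min ((s * y)\<^sup>2) 1 + indicator {y. 1 < \<bar>inverse e * s * y\<bar>} y + 3 * (\<bar>s * y\<bar> * indicator {y. 1 < \<bar>s * y\<bar>} y)"
      using iexp_truncated_bound[OF e, of "s * y"] by simp
  next
    show "integrable \<mu> (\<lambda>y. cmod (iexp (s * y) - 1 - \<i> * complex_of_real (s * y) + complex_of_real (min ((s * y)\<^sup>2) 1) / 2))"
      by (intro integrable_norm Bochner_Integration.integrable_add Bochner_Integration.integrable_diff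
          int1 int2 int3) simp
    show "integrable \<mu> (\<lambda>y. e * min ((s * y)\<^sup>2) 1 + indicator {y. 1 < \<bar>inverse e * s * y\<bar>} y
        + 3 * (\<bar>s * y\<bar> * indicator {y. 1 < \<bar>s * y\<bar>} y))"
      by (rule Bochner_Integration.integrable_add[OF Bochner_Integration.integrable_add[OF iA iB] iC])
  qed
  also have "\<dots> = e * H s + q (inverse e * s) + 3 * T s"
    by (simp only: Bochner_Integration.integral_add[OF Bochner_Integration.integrable_add[OF iA iB] iC]
        Bochner_Integration.integral_add[OF iA iB]
        integral_mult_right_zero truncated_second_moment_def scaled_tail_moment_def q_eq_integral)
  finally show ?thesis .
qed

text \<open>
  Every error term is \<open>o(H)\<close> except \<open>e H\<close>, and \<open>e\<close> is arbitrary.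
\<close>

lemma char_expansion: "((\<lambda>s. cmod (char \<mu> s - 1 + H s / 2) / H s) \<longlongrightarrow> 0) (at 0)"
proof (rule tendstoI)
  fix r :: real assume r: "r > 0"
  define e where "e = min 1 (r / 2)"
  have e: "0 < e" "e \<le> 1" "e \<le> r / 2" using r by (auto simp: e_def)
  \<comment> \<open>The term \<open>3 T\<close> of the bound is at most \<open>18 q\<close> near 0.\<close>
  have "((\<lambda>s. q (inverse e * s) / H s + 18 * (q s / H s)) \<longlongrightarrow> 0) (at 0)"
    using e by (intro tendsto_add_zero tail_negligible_scaled tendsto_mult_right_zero tail_negligible) auto
  then have "\<forall>\<^sub>F s in at 0. q (inverse e * s) / H s + 18 * (q s / H s) < r / 2"
    using r by (intro order_tendstoD) auto
  moreover have "\<forall>\<^sub>F s in at (0::real). s \<noteq> 0" by (auto simp: eventually_at intro!: exI[of _ 1])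
  ultimately show "\<forall>\<^sub>F s in at 0. dist (cmod (char \<mu> s - 1 + H s / 2) / H s) 0 < r"
    using T_le_tail
  proof eventually_elim
    case (elim s)
    have "cmod (char \<mu> s - 1 + H s / 2) \<le> e * H s + q (inverse e * s) + 18 * q s"
      using char_expansion_bound[OF e(1,2), of s] elim by linarith
    then have "cmod (char \<mu> s - 1 + H s / 2) / H s \<le> (e * H s + q (inverse e * s) + 18 * q s) / H s"
      by (rule divide_right_mono) simp
    also have "\<dots> = e + (q (inverse e * s) / H s + 18 * (q s / H s))"
      using H_pos[of s] elim(2) by (simp add: add_divide_distrib)
    also have "\<dots> < r" using elim e by linarith
    finally show ?case by simp
  qed
qed

text \<open>
  The error of replacing a factor of the characteristic function of a sum by an exponential.
  Products of these exponentials collapse to the exponential of a sum.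
\<close>

definition D :: "real \<Rightarrow> real" where "D s = cmod (char \<mu> s - exp (- H s / 2))"

lemma D_nonneg [simp]: "0 \<le> D s" by (simp add: D_def)

lemma D_le_2: "D s \<le> 2"
proof -
  have "D s \<le> cmod (char \<mu> s) + cmod (exp (- H s / 2))" unfolding D_def by (rule norm_triangle_ineq4)
  also have "cmod (exp (- H s / 2)) \<le> 1" by (simp add: norm_exp_eq_Re)
  finally show ?thesis using cmod_char_le_1[of s] by linarith
qed

lemma D_negligible: "((\<lambda>s. D s / H s) \<longlongrightarrow> 0) (at 0)"
proof (rule Lim_null_comparison)
  show "((\<lambda>s. cmod (char \<mu> s - 1 + H s / 2) / H s + H s) \<longlongrightarrow> 0) (at 0)"
    by (intro tendsto_add_zero char_expansion H_tendsto_0)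
  have "norm (D s / H s) \<le> cmod (char \<mu> s - 1 + H s / 2) / H s + H s" if "s \<noteq> 0" for s
  proof -
    have "\<bar>exp (- H s / 2) - (1 - H s / 2)\<bar> \<le> (H s)\<^sup>2"
    proof -
      have l: "1 + (- H s / 2) \<le> exp (- H s / 2)" by (rule exp_ge_add_one_self)
      \<comment> \<open>The upper bound uses \<open>1/(1 + h/2) \<le> 1 - h/2 + h\<^sup>2\<close> for \<open>h \<ge> 0\<close>.\<close>
      have "exp (- H s / 2) \<le> 1 / (1 + H s / 2)"
        unfolding minus_divide_left[symmetric] exp_minus inverse_eq_divide
        using exp_ge_add_one_self[of "H s / 2"] H_nonneg[of s]
        by (intro divide_left_mono) (auto intro!: mult_pos_pos add_pos_nonneg)
      also have "\<dots> \<le> 1 - H s / 2 + (H s)\<^sup>2"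
      proof -
        have "1 \<le> (1 - H s / 2 + (H s)\<^sup>2) * (1 + H s / 2)"
          using H_nonneg[of s] by (simp add: algebra_simps power2_eq_square)
        then show ?thesis using H_nonneg[of s] by (simp add: pos_divide_le_eq add_pos_nonneg)
      qed
      finally show ?thesis using l by (auto simp: abs_le_iff)
    qed
    then have 1: "cmod (of_real (exp (- H s / 2) - (1 - H s / 2))) \<le> (H s)\<^sup>2"
      by (simp only: norm_of_real)
    have "D s = cmod ((char \<mu> s - 1 + H s / 2) - of_real (exp (- H s / 2) - (1 - H s / 2)))"
      by (simp add: D_def exp_of_real[symmetric])
    also have "\<dots> \<le> cmod (char \<mu> s - 1 + H s / 2) + (H s)\<^sup>2"
      using norm_triangle_ineq4 1 by (rule order_trans[OF _ add_left_mono])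
    finally have "D s / H s \<le> (cmod (char \<mu> s - 1 + H s / 2) + (H s)\<^sup>2) / H s"
      by (intro divide_right_mono) auto
    then show ?thesis using H_pos[OF that] by (simp add: add_divide_distrib power2_eq_square)
  qed
  then show "\<forall>\<^sub>F s in at 0. norm (D s / H s) \<le> cmod (char \<mu> s - 1 + H s / 2) / H s + H s"
    by (auto simp: eventually_at intro!: exI[of _ 1])
qed

text \<open>
  Near 0 this is \<open>D = o(H)\<close>. Away from 0 the function \<open>H\<close> is bounded below, by monotonicity, and \<open>D \<le> 2\<close>.
\<close>

lemma D_dominated: obtains C where "0 \<le> C" "\<And>s. D s \<le> C * H s"
proof -
  have "\<forall>\<^sub>F s in at 0. D s / H s < 1" using D_negligible by (rule order_tendstoD) auto
  then obtain d where d: "d > 0" "\<And>s. s \<noteq> 0 \<Longrightarrow> \<bar>s\<bar> < d \<Longrightarrow> D s / H s < 1"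
    by (auto simp: eventually_at dist_real_def)
  have Hd: "0 < H d" using d by (intro H_pos) auto
  have "D s \<le> max 1 (2 / H d) * H s" for s
  proof (cases "s = 0")
    case True then show ?thesis by (simp add: D_def char_zero)
  next
    case s: False
    show ?thesis
    proof (cases "\<bar>s\<bar> < d")
      case True
      then have "D s \<le> 1 * H s" using d(2)[OF s True] H_pos[OF s] by (simp add: field_simps)
      also have "\<dots> \<le> max 1 (2 / H d) * H s" by (intro mult_right_mono) auto
      finally show ?thesis .
    next
      case False
      have "D s \<le> 2 / H d * H d" using D_le_2[of s] Hd by simp
      also have "\<dots> \<le> 2 / H d * H s" using False d(1) Hd by (intro mult_left_mono H_mono) auto
      also have "\<dots> \<le> max 1 (2 / H d) * H s" by (intro mult_right_mono) auto
      finally show ?thesis .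
    qed
  qed
  then show ?thesis by (intro that[of "max 1 (2 / H d)"]) auto
qed

end

text \<open>
  At \<open>s = 1/x\<close> the tail is \<open>L(1/|s|) s\<^sup>2\<close>, so the slow variation of \<open>L\<close> leaves exactly the factor \<open>c\<^sup>2\<close>.
\<close>

lemma regularly_varying_square_tail:
  assumes "prob_space M" and [measurable]: "Z \<in> borel_measurable M"
    and rv: "regularly_varying M Z 2" and int: "integrable M Z" and mean: "(\<integral>\<omega>. Z \<omega> \<partial>M) = 0"
  shows "square_tail_distribution (distr M borel Z)"
proof -
  interpret prob_space M by fact
  interpret \<mu>: real_distribution "distr M borel Z" by (rule real_distribution_distr) simp
  obtain L where pos: "\<forall>\<^sub>F x in at_top. L x > 0"
    and slow: "\<And>c. c > 0 \<Longrightarrow> ((\<lambda>x. L (c * x) / L x) \<longlongrightarrow> 1) at_top"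
    and tail: "\<And>x. x > 0 \<Longrightarrow> \<P>(\<omega> in M. \<bar>Z \<omega>\<bar> > x) = L x * x powr (- 2)"
    using rv by (auto simp: regularly_varying_def slowly_varying_def)
  let ?q = "scaled_tail (distr M borel Z)"
  have q: "?q s = L (1 / \<bar>s\<bar>) * s\<^sup>2" if s: "s \<noteq> 0" for s
  proof -
    have "?q s = \<P>(\<omega> in M. \<bar>Z \<omega>\<bar> > 1 / \<bar>s\<bar>)"
      unfolding scaled_tail_def using s
      by (subst measure_distr) (auto intro!: arg_cong[where f=prob] simp: abs_mult field_simps)
    also have "\<dots> = L (1 / \<bar>s\<bar>) * (1 / \<bar>s\<bar>) powr (- 2)" using s by (intro tail) auto
    also have "(1 / \<bar>s\<bar>) powr (- 2) = s\<^sup>2"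
      using s by (simp add: powr_minus powr_numeral power_divide)
    finally show ?thesis .
  qed
  have inf: "filterlim (\<lambda>s::real. 1 / \<bar>s\<bar>) at_top (at 0)"
  proof -
    have "filterlim (\<lambda>s::real. \<bar>s\<bar>) (at_right 0) (at 0)"
      by (auto simp: filterlim_at eventually_at intro!: tendsto_eq_intros exI[of _ 1])
    then show ?thesis
      using filterlim_compose[OF filterlim_inverse_at_top_right] by (simp add: inverse_eq_divide)
  qed
  show ?thesis
  proof
    show "((\<lambda>s. ?q (c * s) / ?q s) \<longlongrightarrow> c\<^sup>2) (at 0)" if c: "c \<noteq> 0" for c
    proof -
      have "((\<lambda>s. L (1 / \<bar>c\<bar> * (1 / \<bar>s\<bar>)) / L (1 / \<bar>s\<bar>) * c\<^sup>2) \<longlongrightarrow> 1 * c\<^sup>2) (at 0)"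
        using c by (intro tendsto_mult_right filterlim_compose[OF slow inf]) auto
      moreover have "\<forall>\<^sub>F s in at 0. ?q (c * s) / ?q s = L (1 / \<bar>c\<bar> * (1 / \<bar>s\<bar>)) / L (1 / \<bar>s\<bar>) * c\<^sup>2"
        using c by (auto simp: eventually_at q abs_mult power_mult_distrib intro!: exI[of _ 1])
      ultimately show ?thesis by (subst tendsto_cong) simp_all
    qed
    have "\<forall>\<^sub>F s in at 0. 0 < L (1 / \<bar>s\<bar>)"
      using inf pos by (auto simp: filterlim_iff)
    moreover have "\<forall>\<^sub>F s in at (0::real). s \<noteq> 0" by (auto simp: eventually_at intro!: exI[of _ 1])
    ultimately show "\<forall>\<^sub>F s in at 0. 0 < ?q s" by eventually_elim (simp add: q)
    show "integrable (distr M borel Z) (\<lambda>y. y)" using int by (simp add: integrable_distr_eq)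
    show "(\<integral>y. y \<partial>distr M borel Z) = 0" using mean by (simp add: integral_distr)
  qed
qed

text \<open>
  The two terms of the normalizing equation are the parts \<open>|Z| > a\<^sub>n\<close> and \<open>|Z| \<le> a\<^sub>n\<close> of the truncated
  second moment at \<open>s = 1/a\<^sub>n\<close>.
\<close>

lemma normalizing_sequence_truncated_moment:
  assumes M: "prob_space M" and Z[measurable]: "Z \<in> borel_measurable M" and norming: "normalizing_sequence M Z a"
  defines "\<mu> \<equiv> distr M borel Z"
  shows "\<forall>\<^sub>F n in sequentially. 0 < a n \<and> real n * truncated_second_moment \<mu> (inverse (a n)) = 1"
  using norming unfolding normalizing_sequence_def
proof eventually_elim
  case (elim n)
  interpret prob_space M by fact
  let ?b = "a n"
  have b: "0 < ?b" using elim by simp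
  have eq: "min ((inverse ?b * z)\<^sup>2) 1 = indicator {z. \<bar>z\<bar> > ?b} z + z\<^sup>2 * indicator {z. \<bar>z\<bar> \<le> ?b} z / ?b\<^sup>2" for z
  proof (cases "\<bar>z\<bar> \<le> ?b")
    case True
    then have "z\<^sup>2 \<le> ?b\<^sup>2" using power_mono[of "\<bar>z\<bar>" ?b 2] by simp
    then show ?thesis using True b by (simp add: power_mult_distrib power_inverse field_simps min_def)
  next
    case False
    then have "?b\<^sup>2 \<le> z\<^sup>2" using b power_mono[of ?b "\<bar>z\<bar>" 2] by simp
    then show ?thesis using False b by (simp add: power_mult_distrib power_inverse field_simps min_def)
  qed
  have i1: "integrable M (\<lambda>\<omega>. indicator {z. \<bar>z\<bar> > ?b} (Z \<omega>) :: real)"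
    by (rule integrable_const_bound[where B=1]) (auto simp: indicator_def)
  have i2: "integrable M (\<lambda>\<omega>. (Z \<omega>)\<^sup>2 * indicator {z. \<bar>z\<bar> \<le> ?b} (Z \<omega>) / ?b\<^sup>2)"
  proof (rule integrable_const_bound[where B=1])
    show "AE \<omega> in M. norm ((Z \<omega>)\<^sup>2 * indicator {z. \<bar>z\<bar> \<le> ?b} (Z \<omega>) / ?b\<^sup>2) \<le> 1"
    proof (rule AE_I2)
      fix \<omega>
      show "norm ((Z \<omega>)\<^sup>2 * indicator {z. \<bar>z\<bar> \<le> ?b} (Z \<omega>) / ?b\<^sup>2) \<le> 1"
        using b power_mono[of "\<bar>Z \<omega>\<bar>" ?b 2] by (auto simp: indicator_def)
    qed
  qed measurable
  have "truncated_second_moment \<mu> (inverse ?b) = (\<integral>\<omega>. min ((inverse ?b * Z \<omega>)\<^sup>2) 1 \<partial>M)"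
    unfolding truncated_second_moment_def \<mu>_def by (rule integral_distr) measurable
  also have "\<dots> = (\<integral>\<omega>. indicator {z. \<bar>z\<bar> > ?b} (Z \<omega>) \<partial>M)
      + (\<integral>\<omega>. (Z \<omega>)\<^sup>2 * indicator {z. \<bar>z\<bar> \<le> ?b} (Z \<omega>) / ?b\<^sup>2 \<partial>M)"
    unfolding eq by (rule Bochner_Integration.integral_add[OF i1 i2])
  also have "(\<integral>\<omega>. indicator {z. \<bar>z\<bar> > ?b} (Z \<omega>) \<partial>M) = \<P>(\<omega> in M. \<bar>Z \<omega>\<bar> > ?b)"
  proof -
    have "(\<integral>\<omega>. indicator {z. \<bar>z\<bar> > ?b} (Z \<omega>) \<partial>M :: real) = (\<integral>\<omega>. indicator {\<omega>\<in>space M. \<bar>Z \<omega>\<bar> > ?b} \<omega> \<partial>M)"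
      by (intro Bochner_Integration.integral_cong) (auto simp: indicator_def)
    then show ?thesis by simp
  qed
  also have "(\<integral>\<omega>. (Z \<omega>)\<^sup>2 * indicator {z. \<bar>z\<bar> \<le> ?b} (Z \<omega>) / ?b\<^sup>2 \<partial>M)
      = (\<integral>\<omega>. (Z \<omega>)\<^sup>2 * indicator {\<omega>. \<bar>Z \<omega>\<bar> \<le> ?b} \<omega> \<partial>M) / ?b\<^sup>2"
    by (simp add: indicator_def of_bool_def)
  finally show ?case using elim by (simp add: distrib_left)
qed

text \<open>
  The equation forces \<open>H(s\<^sub>n) = 1/n\<close>, whereas \<open>H\<close> is bounded below by \<open>H(e) > 0\<close> outside \<open>(-e, e)\<close>.
\<close>

lemma (in square_tail_distribution) normalized_tendsto_0:
  assumes "\<forall>\<^sub>F n in sequentially. s n \<noteq> 0 \<and> real n * H (s n) = 1"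
  shows "filterlim s (at 0) sequentially"
proof (rule filterlim_atI)
  show "\<forall>\<^sub>F n in sequentially. s n \<noteq> 0" using assms by eventually_elim simp
  show "s \<longlonglongrightarrow> 0"
  proof (rule tendstoI)
    fix e :: real assume e: "e > 0"
    have "(\<lambda>n. inverse (real n)) \<longlonglongrightarrow> 0" by (rule lim_inverse_n)
    then have "\<forall>\<^sub>F n in sequentially. inverse (real n) < H e"
      using H_pos[of e] e by (intro order_tendstoD) auto
    with assms show "\<forall>\<^sub>F n in sequentially. dist (s n) 0 < e"
    proof eventually_elim
      case (elim n)
      have "H (s n) < H e" using elim inverse_unique[of "real n" "H (s n)"] by simp
      then have "\<not> e \<le> \<bar>s n\<bar>" using H_mono[of e "s n"] e by auto
      then show ?case by simp
    qed
  qed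
qed

section \<open>Almost sure convergence of series of independent variables\<close>

lemma (in prob_space) indep_vars_reindex:
  assumes inj: "inj_on f I" and indep: "indep_vars (\<lambda>_. N) X (f ` I)"
  shows "indep_vars (\<lambda>_. N) (\<lambda>i. X (f i)) I"
  unfolding indep_vars_def2
proof safe
  show "X (f i) \<in> M \<rightarrow>\<^sub>M N" if "i \<in> I" for i
    using indep that by (auto simp: indep_vars_def2)
  show "indep_sets (\<lambda>i. {X (f i) -` A \<inter> space M |A. A \<in> sets N}) I"
  proof (rule indep_setsI)
    show "{X (f i) -` A \<inter> space M |A. A \<in> sets N} \<subseteq> events" if "i \<in> I" for i
      using indep that by (auto simp: indep_vars_def2)
    fix A J assume J: "J \<noteq> {}" "J \<subseteq> I" "finite J"
      and A: "\<forall>j\<in>J. A j \<in> {X (f j) -` A \<inter> space M |A. A \<in> sets N}"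
    define g where "g = the_inv_into J f"
    have g: "g (f j) = j" if "j \<in> J" for j
      using inj_on_subset[OF inj J(2)] that by (simp add: g_def the_inv_into_f_f)
    have "prob (\<Inter>k\<in>f ` J. A (g k)) = (\<Prod>k\<in>f ` J. prob (A (g k)))"
    proof (rule indep_setsD)
      show "indep_sets (\<lambda>i. {X i -` A \<inter> space M |A. A \<in> sets N}) (f ` I)"
        using indep by (simp add: indep_vars_def2)
      show "\<forall>k\<in>f ` J. A (g k) \<in> {X k -` A \<inter> space M |A. A \<in> sets N}"
        using A by (auto simp: g)
    qed (use J in auto)
    then show "prob (\<Inter>j\<in>J. A j) = (\<Prod>j\<in>J. prob (A j))"
      using inj_on_subset[OF inj J(2)] by (simp add: prod.reindex g)
  qed
qed

lemma (in prob_space) expectation_power2_le: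
  fixes X :: "'a \<Rightarrow> real"
  assumes [measurable]: "X \<in> borel_measurable M" and int: "integrable M (\<lambda>\<omega>. (X \<omega>)\<^sup>2)"
  shows "integrable M X" "(expectation X)\<^sup>2 \<le> expectation (\<lambda>\<omega>. (X \<omega>)\<^sup>2)"
proof -
  show 1: "integrable M X"
    using int by (rule square_integrable_imp_integrable[rotated]) simp
  have "0 \<le> variance X" by (rule variance_positive)
  then show "(expectation X)\<^sup>2 \<le> expectation (\<lambda>\<omega>. (X \<omega>)\<^sup>2)"
    using variance_eq[OF 1 int] by simp
qed

text \<open>
  The partial sums of \<open>x\<close>, frozen as soon as they reach \<open>e\<close> in absolute value. Bounding the second moment
  of the frozen walk at one fixed time controls the maximum of the original walk.
\<close>

fun stopped_sum :: "real \<Rightarrow> (nat \<Rightarrow> real) \<Rightarrow> nat \<Rightarrow> real" where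
  "stopped_sum e x 0 = 0"
| "stopped_sum e x (Suc k) =
     (if e \<le> \<bar>stopped_sum e x k\<bar> then stopped_sum e x k else stopped_sum e x k + x k)"

lemma stopped_sum_exceeds:
  assumes "k \<le> n" "e \<le> \<bar>\<Sum>i<k. x i\<bar>"
  shows "e \<le> \<bar>stopped_sum e x n\<bar>"
proof -
  have "e \<le> \<bar>stopped_sum e x n\<bar> \<or>
      (stopped_sum e x n = (\<Sum>i<n. x i) \<and> (\<forall>k\<le>n. \<bar>\<Sum>i<k. x i\<bar> < e))"
    by (induction n) (auto simp: le_Suc_eq)
  with assms show ?thesis by force
qed

lemma stopped_sum_cong: "(\<And>i. i < k \<Longrightarrow> x i = y i) \<Longrightarrow> stopped_sum e x k = stopped_sum e y k"
  by (induction k) auto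

lemma stopped_sum_measurable:
  assumes "{..<k} \<subseteq> J"
  shows "(\<lambda>x. stopped_sum e x k) \<in> borel_measurable (PiM J (\<lambda>_. borel))"
  using assms
proof (induction k)
  case (Suc k)
  have "{..<k} \<subseteq> J" "k \<in> J" using Suc.prems by (auto simp: lessThan_Suc)
  then have [measurable]: "(\<lambda>x. stopped_sum e x k) \<in> borel_measurable (PiM J (\<lambda>_. borel))"
    and "k \<in> J" using Suc.IH by auto
  then show ?case by simp
qed simp

locale independent_centered = prob_space +
  fixes X :: "nat \<Rightarrow> 'a \<Rightarrow> real"
  assumes indep: "indep_vars (\<lambda>_. borel) X UNIV"
    and square_integrable: "\<And>i. integrable M (\<lambda>\<omega>. (X i \<omega>)\<^sup>2)"
    and centered: "\<And>i. expectation (X i) = 0"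
begin

lemma rv [measurable]: "X i \<in> borel_measurable M"
  using indep by (auto simp: indep_vars_def)

abbreviation "stopped e k \<omega> \<equiv> stopped_sum e (\<lambda>i. X i \<omega>) k"

lemma stopped_measurable [measurable]: "stopped e k \<in> borel_measurable M"
  by (induction k) auto

text \<open>
  The value of the stopped walk at time \<open>k\<close> is a function of the summands before \<open>k\<close>, hence independent
  of the centred variable \<open>X k\<close>. This orthogonality makes the second moment grow by at most that of \<open>X k\<close>.
\<close>

lemma stopped_cross_moment:
  assumes "e > 0"
  shows "integrable M (\<lambda>\<omega>. (if e \<le> \<bar>stopped e k \<omega>\<bar> then 0 else stopped e k \<omega>) * X k \<omega>)"
    and "expectation (\<lambda>\<omega>. (if e \<le> \<bar>stopped e k \<omega>\<bar> then 0 else stopped e k \<omega>) * X k \<omega>) = 0"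
proof -
  let ?G = "\<lambda>\<omega>. if e \<le> \<bar>stopped e k \<omega>\<bar> then 0 else stopped e k \<omega>"
  let ?g = "\<lambda>x. if e \<le> \<bar>stopped_sum e x k\<bar> then 0 else stopped_sum e x k"
  have [measurable]: "(\<lambda>x. stopped_sum e x k) \<in> borel_measurable (PiM {..<k} (\<lambda>_. borel))"
    by (rule stopped_sum_measurable) simp
  have "indep_var borel (?g \<circ> (\<lambda>\<omega>. restrict (\<lambda>i. X i \<omega>) {..<k}))
      borel ((\<lambda>x. x k) \<circ> (\<lambda>\<omega>. restrict (\<lambda>i. X i \<omega>) {k}))"
    by (intro indep_var_compose[OF indep_var_restrict[OF indep]]) auto
  moreover have "?g \<circ> (\<lambda>\<omega>. restrict (\<lambda>i. X i \<omega>) {..<k}) = ?G"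
    using stopped_sum_cong[of k "restrict (\<lambda>i. X i _) {..<k}" "\<lambda>i. X i _" e] by (simp add: fun_eq_iff)
  ultimately have "indep_var borel ?G borel (X k)" by (simp add: comp_def)
  moreover have "integrable M ?G"
    by (rule integrable_const_bound[where B=e]) (use assms in auto)
  moreover have "integrable M (X k)" by (rule expectation_power2_le[OF rv square_integrable])
  ultimately show "integrable M (\<lambda>\<omega>. ?G \<omega> * X k \<omega>)" "expectation (\<lambda>\<omega>. ?G \<omega> * X k \<omega>) = 0"
    by (simp_all add: indep_var_integrable indep_var_lebesgue_integral centered)
qed

lemma stopped_second_moment:
  assumes e: "e > 0"
  shows "integrable M (\<lambda>\<omega>. (stopped e k \<omega>)\<^sup>2)
    \<and> expectation (\<lambda>\<omega>. (stopped e k \<omega>)\<^sup>2) \<le> (\<Sum>i<k. expectation (\<lambda>\<omega>. (X i \<omega>)\<^sup>2))"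
proof (induction k)
  case (Suc k)
  let ?G = "\<lambda>\<omega>. if e \<le> \<bar>stopped e k \<omega>\<bar> then 0 else stopped e k \<omega>"
  let ?B = "\<lambda>\<omega>. (stopped e k \<omega>)\<^sup>2 + 2 * (?G \<omega> * X k \<omega>) + (X k \<omega>)\<^sup>2"
  note cross = stopped_cross_moment[OF e, of k]
  have B: "integrable M ?B"
    using Suc cross square_integrable[of k]
    by (intro Bochner_Integration.integrable_add integrable_mult_right) auto
  have le: "(stopped e (Suc k) \<omega>)\<^sup>2 \<le> ?B \<omega>" for \<omega>
    by (simp add: power2_eq_square algebra_simps)
  have int: "integrable M (\<lambda>\<omega>. (stopped e (Suc k) \<omega>)\<^sup>2)"
  proof (rule Bochner_Integration.integrable_bound[OF B])
    show "AE \<omega> in M. norm ((stopped e (Suc k) \<omega>)\<^sup>2) \<le> norm (?B \<omega>)"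
      by (intro AE_I2) (simp only: real_norm_def abs_power2 order_trans[OF le abs_ge_self])
  qed measurable
  have "expectation (\<lambda>\<omega>. (stopped e (Suc k) \<omega>)\<^sup>2) \<le> expectation ?B"
    by (intro integral_mono int B le)
  also have "\<dots> = expectation (\<lambda>\<omega>. (stopped e k \<omega>)\<^sup>2) + 2 * expectation (\<lambda>\<omega>. ?G \<omega> * X k \<omega>)
      + expectation (\<lambda>\<omega>. (X k \<omega>)\<^sup>2)"
    using Suc cross(1) square_integrable[of k] by simp
  also have "\<dots> \<le> (\<Sum>i<Suc k. expectation (\<lambda>\<omega>. (X i \<omega>)\<^sup>2))" using Suc cross(2) by simp
  finally show ?case using int by simp
qed simp

text \<open>
  Kolmogorov's maximal inequality: Markov's inequality for the square of the stopped walk.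
\<close>

lemma maximal_inequality:
  assumes e: "e > 0"
  shows "prob {\<omega>\<in>space M. \<exists>k\<le>n. e \<le> \<bar>\<Sum>i<k. X i \<omega>\<bar>} \<le> (\<Sum>i<n. expectation (\<lambda>\<omega>. (X i \<omega>)\<^sup>2)) / e\<^sup>2"
proof -
  have "prob {\<omega>\<in>space M. \<exists>k\<le>n. e \<le> \<bar>\<Sum>i<k. X i \<omega>\<bar>} \<le> prob {\<omega>\<in>space M. e\<^sup>2 \<le> (stopped e n \<omega>)\<^sup>2}"
    using e by (intro finite_measure_mono) (auto intro!: power_mono stopped_sum_exceeds simp: abs_le_square_iff[symmetric] simp del: power2_abs)
  also have "\<dots> \<le> expectation (\<lambda>\<omega>. (stopped e n \<omega>)\<^sup>2) / e\<^sup>2"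
    using e stopped_second_moment[OF e, of n] by (intro integral_Markov_inequality_measure[where A="{}"]) auto
  also have "\<dots> \<le> (\<Sum>i<n. expectation (\<lambda>\<omega>. (X i \<omega>)\<^sup>2)) / e\<^sup>2"
    using stopped_second_moment[OF e, of n] by (intro divide_right_mono) auto
  finally show ?thesis .
qed

lemma maximal_inequality_sup:
  assumes e: "e > 0" and sm: "summable (\<lambda>i. expectation (\<lambda>\<omega>. (X i \<omega>)\<^sup>2))"
  shows "prob {\<omega>\<in>space M. \<exists>k. e \<le> \<bar>\<Sum>i<k. X i \<omega>\<bar>} \<le> (\<Sum>i. expectation (\<lambda>\<omega>. (X i \<omega>)\<^sup>2)) / e\<^sup>2"
proof -
  let ?A = "\<lambda>n. {\<omega>\<in>space M. \<exists>k\<le>n. e \<le> \<bar>\<Sum>i<k. X i \<omega>\<bar>}"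
  have "(\<lambda>n. prob (?A n)) \<longlonglongrightarrow> prob (\<Union>n. ?A n)"
    by (rule finite_Lim_measure_incseq) (auto simp: incseq_def intro: order_trans)
  moreover have "prob (?A n) \<le> (\<Sum>i. expectation (\<lambda>\<omega>. (X i \<omega>)\<^sup>2)) / e\<^sup>2" for n
    using sum_le_suminf[OF sm, of "{..<n}"]
    by (intro order_trans[OF maximal_inequality[OF e]] divide_right_mono) auto
  moreover have "(\<Union>n. ?A n) = {\<omega>\<in>space M. \<exists>k. e \<le> \<bar>\<Sum>i<k. X i \<omega>\<bar>}" by auto
  ultimately show ?thesis using LIMSEQ_le_const2 by (metis (no_types, lifting))
qed

end

text \<open>
  Kolmogorov's one-series theorem. The maximal inequality for the sequence started at \<open>m\<close> bounds the
  oscillation of the partial sums after \<open>m\<close> by a tail of the variance series, so almost surely the partial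
  sums form a Cauchy sequence.
\<close>

theorem (in independent_centered) AE_summable:
  assumes sm: "summable (\<lambda>i. expectation (\<lambda>\<omega>. (X i \<omega>)\<^sup>2))"
  shows "AE \<omega> in M. summable (\<lambda>i. X i \<omega>)"
proof -
  have tail: "AE \<omega> in M. \<exists>m. \<forall>k. \<bar>\<Sum>i<k. X (m + i) \<omega>\<bar> < e" if e: "e > 0" for e
  proof -
    let ?N = "\<lambda>m. {\<omega>\<in>space M. \<exists>k. e \<le> \<bar>\<Sum>i<k. X (m + i) \<omega>\<bar>}"
    let ?r = "\<lambda>m. (\<Sum>i. expectation (\<lambda>\<omega>. (X (i + m) \<omega>)\<^sup>2)) / e\<^sup>2"
    have N: "prob (?N m) \<le> ?r m" for m
    proof -
      interpret shifted: independent_centered M "\<lambda>i. X (m + i)"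
        by unfold_locales
           (auto intro!: indep_vars_reindex[where X=X] indep_vars_subset[OF indep] square_integrable centered)
      show ?thesis
        using shifted.maximal_inequality_sup[OF e] summable_ignore_initial_segment[OF sm, of m]
        by (simp add: add.commute[of m])
    qed
    have "?r \<longlonglongrightarrow> 0 / e\<^sup>2" 
      using suminf_exist_split2[OF sm] e by (intro tendsto_divide) auto
    then have r: "?r \<longlonglongrightarrow> 0" by simp
    have "prob (\<Inter>m. ?N m) \<le> ?r m" for m
      by (intro order_trans[OF finite_measure_mono N[of m]]) auto
    then have "prob (\<Inter>m. ?N m) \<le> 0" using LIMSEQ_le_const[OF r] by blast
    then have "prob (\<Inter>m. ?N m) = 0" by (simp add: measure_le_0_iff)
    moreover have "(\<Inter>m. ?N m) \<in> events" by measurable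
    ultimately have "(\<Inter>m. ?N m) \<in> null_sets M" by (simp add: emeasure_eq_measure null_setsI)
    then show ?thesis by (rule AE_I') (auto simp: not_less)
  qed
  then have "AE \<omega> in M. \<forall>r::nat. \<exists>m. \<forall>k. \<bar>\<Sum>i<k. X (m + i) \<omega>\<bar> < inverse (Suc r)"
    by (subst AE_all_countable) auto
  then show ?thesis
  proof (rule AE_mp[OF _ AE_I2], intro impI)
    fix \<omega> assume c: "\<forall>r::nat. \<exists>m. \<forall>k. \<bar>\<Sum>i<k. X (m + i) \<omega>\<bar> < inverse (Suc r)"
    show "summable (\<lambda>i. X i \<omega>)"
      unfolding summable_Cauchy
    proof safe
      fix d :: real assume "d > 0"
      then obtain r where r: "inverse (Suc r) < d / 2" using reals_Archimedean[of "d/2"] by auto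
      obtain m where m: "\<And>k. \<bar>\<Sum>i<k. X (m + i) \<omega>\<bar> < inverse (Suc r)" using c by blast
      have block: "(\<Sum>i<j - m. X (m + i) \<omega>) = (\<Sum>i=m..<j. X i \<omega>)" if "m \<le> j" for j
        using that sum.shift_bounds_nat_ivl[of "\<lambda>i. X i \<omega>" 0 m "j - m"]
        by (simp add: atLeast0LessThan add.commute)
      have "norm (\<Sum>i=j..<k. X i \<omega>) < d" if "m \<le> j" for j k
      proof (cases "j \<le> k")
        case True
        have "(\<Sum>i=m..<k. X i \<omega>) = (\<Sum>i=m..<j. X i \<omega>) + (\<Sum>i=j..<k. X i \<omega>)"
          using that True by (simp add: sum.atLeastLessThan_concat)
        then show ?thesis using m[of "j - m"] m[of "k - m"] r block[of j] block[of k] that True by (auto simp: abs_less_iff)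
      qed (use \<open>d > 0\<close> in simp)
      then show "\<exists>N. \<forall>m\<ge>N. \<forall>n. norm (\<Sum>i=m..<n. X i \<omega>) < d" by blast
    qed
  qed
qed

section \<open>A weak law for log-normal moving averages\<close>

text \<open>
  Completing the square turns the integrand into a shifted normal density.
\<close>

lemma (in prob_space) std_normal_exp_moment:
  assumes X: "distributed M lborel X std_normal_density"
  shows "integrable M (\<lambda>\<omega>. exp (c * X \<omega>))"
    and "expectation (\<lambda>\<omega>. exp (c * X \<omega>)) = exp (c\<^sup>2 / 2)"
proof -
  have eq: "std_normal_density x * exp (c * x) = exp (c\<^sup>2 / 2) * normal_density c 1 x" for x
    by (simp add: normal_density_def exp_add[symmetric] power2_eq_square field_simps)
  have "integrable lborel (\<lambda>x. std_normal_density x * exp (c * x))"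
    unfolding eq by simp
  then show "integrable M (\<lambda>\<omega>. exp (c * X \<omega>))"
    using distributed_integrable[OF X, of "\<lambda>x. exp (c * x)"] by simp
  have "expectation (\<lambda>\<omega>. exp (c * X \<omega>)) = (\<integral>x. std_normal_density x * exp (c * x) \<partial>lborel)"
    using distributed_integral[OF X, of "\<lambda>x. exp (c * x)"] by simp
  also have "\<dots> = exp (c\<^sup>2 / 2)" unfolding eq by simp
  finally show "expectation (\<lambda>\<omega>. exp (c * X \<omega>)) = exp (c\<^sup>2 / 2)" .
qed

locale gaussian_noise = prob_space +
  fixes \<eta> :: "int \<Rightarrow> 'a \<Rightarrow> real"
  assumes indep_noise: "indep_vars (\<lambda>_. borel) \<eta> UNIV"
    and std_normal: "\<And>t. distributed M lborel (\<eta> t) std_normal_density"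
begin

lemma noise_measurable [measurable]: "\<eta> t \<in> borel_measurable M"
  using indep_noise by (auto simp: indep_vars_def)

lemma linear_exp_moment:
  assumes "finite I"
  shows "integrable M (\<lambda>\<omega>. exp (\<Sum>i\<in>I. c i * \<eta> i \<omega>))"
    and "expectation (\<lambda>\<omega>. exp (\<Sum>i\<in>I. c i * \<eta> i \<omega>)) = exp ((\<Sum>i\<in>I. (c i)\<^sup>2) / 2)"
proof -
  have ind: "indep_vars (\<lambda>_. borel) (\<lambda>i \<omega>. exp (c i * \<eta> i \<omega>)) I"
    by (rule indep_vars_compose2[OF indep_vars_subset[OF indep_noise]]) auto
  note int = std_normal_exp_moment(1)[OF std_normal]
  show "integrable M (\<lambda>\<omega>. exp (\<Sum>i\<in>I. c i * \<eta> i \<omega>))"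
    using indep_vars_integrable[OF assms ind int] by (simp add: exp_sum assms)
  have "expectation (\<lambda>\<omega>. exp (\<Sum>i\<in>I. c i * \<eta> i \<omega>)) = (\<Prod>i\<in>I. exp ((c i)\<^sup>2 / 2))"
    using indep_vars_lebesgue_integral[OF assms ind int]
    by (simp add: exp_sum assms std_normal_exp_moment(2)[OF std_normal])
  then show "expectation (\<lambda>\<omega>. exp (\<Sum>i\<in>I. c i * \<eta> i \<omega>)) = exp ((\<Sum>i\<in>I. (c i)\<^sup>2) / 2)"
    by (simp add: exp_sum assms sum_divide_distrib)
qed

text \<open>
  A moving average of the noise of length \<open>m\<close>. The coefficients are arbitrary because doubling and mixing
  averages, as happens in second moments, then stays within the same family.
\<close>

definition filtered :: "(nat \<Rightarrow> real) \<Rightarrow> nat \<Rightarrow> int \<Rightarrow> 'a \<Rightarrow> real" where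
  "filtered c m t \<omega> = (\<Sum>j<m. c j * \<eta> (t - int j) \<omega>)"

lemma filtered_measurable [measurable]: "filtered c m t \<in> borel_measurable M"
  unfolding filtered_def by measurable

lemma filtered_eq_sum: "filtered c m t \<omega> = (\<Sum>i\<in>{t - int m<..t}. c (nat (t - i)) * \<eta> i \<omega>)"
  unfolding filtered_def
  by (rule sum.reindex_bij_witness[of _ "\<lambda>i. nat (t - i)" "\<lambda>j. t - int j"]) auto

lemma sum_squares_eq: "(\<Sum>i\<in>{t - int m<..t}. (c (nat (t - i)))\<^sup>2) = (\<Sum>j<m. (c j)\<^sup>2)" for c :: "nat \<Rightarrow> real"
  by (rule sum.reindex_bij_witness[of _ "\<lambda>j. t - int j" "\<lambda>i. nat (t - i)"]) auto

lemma filtered_exp_moment: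
  "integrable M (\<lambda>\<omega>. exp (filtered c m t \<omega>))"
  "expectation (\<lambda>\<omega>. exp (filtered c m t \<omega>)) = exp ((\<Sum>j<m. (c j)\<^sup>2) / 2)"
  unfolding filtered_eq_sum
  by (simp_all add: linear_exp_moment sum_squares_eq)

text \<open>
  Averages at times at least \<open>m\<close> apart use disjoint stretches of the noise.
\<close>

lemma filtered_exp_moment_separated:
  assumes "int m \<le> \<bar>s - t\<bar>"
  shows "integrable M (\<lambda>\<omega>. exp (filtered c m s \<omega>) * exp (filtered c m t \<omega>))"
    and "expectation (\<lambda>\<omega>. exp (filtered c m s \<omega>) * exp (filtered c m t \<omega>)) = exp (\<Sum>j<m. (c j)\<^sup>2)"
proof -
  let ?S = "{s - int m<..s}" and ?T = "{t - int m<..t}"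
  define d where "d i = (if i \<in> ?S then c (nat (s - i)) else c (nat (t - i)))" for i
  have disj: "?S \<inter> ?T = {}" using assms by auto
  have "(\<Sum>i\<in>?S \<union> ?T. d i * \<eta> i \<omega>) = filtered c m s \<omega> + filtered c m t \<omega>" for \<omega>
    using disj unfolding filtered_eq_sum
    by (subst sum.union_disjoint) (auto simp: d_def intro!: arg_cong2[where f="(+)"] sum.cong)
  then have 1: "exp (filtered c m s \<omega>) * exp (filtered c m t \<omega>) = exp (\<Sum>i\<in>?S \<union> ?T. d i * \<eta> i \<omega>)" for \<omega>
    by (simp add: exp_add)
  have "(\<Sum>i\<in>?S \<union> ?T. (d i)\<^sup>2) = (\<Sum>i\<in>?S. (c (nat (s - i)))\<^sup>2) + (\<Sum>i\<in>?T. (c (nat (t - i)))\<^sup>2)"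
    using disj by (subst sum.union_disjoint) (auto simp: d_def intro!: arg_cong2[where f="(+)"] sum.cong)
  then have 2: "(\<Sum>i\<in>?S \<union> ?T. (d i)\<^sup>2) = 2 * (\<Sum>j<m. (c j)\<^sup>2)"
    by (simp add: sum_squares_eq)
  show "integrable M (\<lambda>\<omega>. exp (filtered c m s \<omega>) * exp (filtered c m t \<omega>))"
    and "expectation (\<lambda>\<omega>. exp (filtered c m s \<omega>) * exp (filtered c m t \<omega>)) = exp (\<Sum>j<m. (c j)\<^sup>2)"
    unfolding 1 using linear_exp_moment[of "?S \<union> ?T" d] 2 by simp_all
qed

end

text \<open>
  In the second moment of the centred sum only pairs of indices at distance at most \<open>m\<close> contribute;
  there are at most \<open>2 (m + 1) n\<close> of them, against the normalization \<open>n\<^sup>2\<close>.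
\<close>

lemma (in prob_space) weak_law_finite_range:
  fixes W :: "nat \<Rightarrow> 'a \<Rightarrow> real"
  assumes [measurable]: "\<And>t. W t \<in> borel_measurable M"
    and square: "\<And>t. integrable M (\<lambda>\<omega>. (W t \<omega>)\<^sup>2)"
    and bound: "\<And>t. expectation (\<lambda>\<omega>. (W t \<omega>)\<^sup>2) \<le> C"
    and mean: "\<And>t. expectation (W t) = a"
    and separated: "\<And>s t. s + m < t \<or> t + m < s \<Longrightarrow> expectation (\<lambda>\<omega>. W s \<omega> * W t \<omega>) = a\<^sup>2"
  shows "0 < n \<Longrightarrow>
      expectation (\<lambda>\<omega>. \<bar>(\<Sum>t=1..n. W t \<omega>) / real n - a\<bar>) \<le> sqrt (2 * (real m + 1) * C / real n)"
    and "integrable M (\<lambda>\<omega>. \<bar>(\<Sum>t=1..n. W t \<omega>) / real n - a\<bar>)"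
proof -
  have intW: "integrable M (W t)" for t by (rule expectation_power2_le[OF _ square]) measurable
  have xy: "\<bar>x * y\<bar> \<le> x\<^sup>2 + y\<^sup>2" for x y :: real
    using sum_squares_bound[of "\<bar>x\<bar>" "\<bar>y\<bar>"] abs_ge_zero[of "x * y"] by (simp only: abs_mult power2_abs)
  have intWW: "integrable M (\<lambda>\<omega>. W s \<omega> * W t \<omega>)" for s t
    by (rule Bochner_Integration.integrable_bound[OF Bochner_Integration.integrable_add[OF square[of s] square[of t]]])
       (auto intro!: AE_I2 xy)
  show int: "integrable M (\<lambda>\<omega>. \<bar>(\<Sum>t=1..n. W t \<omega>) / real n - a\<bar>)"
    using intW by auto
  let ?c = "\<lambda>s t. expectation (\<lambda>\<omega>. (W s \<omega> - a) * (W t \<omega> - a))"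
  have C0: "0 \<le> C" using order_trans[OF _ bound[of 0]] by simp
  have expand: "(W s \<omega> - a) * (W t \<omega> - a) = W s \<omega> * W t \<omega> - a * W s \<omega> - a * W t \<omega> + a\<^sup>2" for s t \<omega>
    by (simp add: algebra_simps power2_eq_square)
  have intc: "integrable M (\<lambda>\<omega>. (W s \<omega> - a) * (W t \<omega> - a))" for s t
    unfolding expand using intW intWW by auto
  have ceq: "?c s t = expectation (\<lambda>\<omega>. W s \<omega> * W t \<omega>) - a\<^sup>2" for s t
    unfolding expand using intW intWW by (simp add: mean prob_space power2_eq_square)
  have near: "?c s t \<le> C" for s t
  proof -
    have "expectation (\<lambda>\<omega>. W s \<omega> * W t \<omega>) \<le> expectation (\<lambda>\<omega>. ((W s \<omega>)\<^sup>2 + (W t \<omega>)\<^sup>2) / 2)"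
    proof (intro integral_mono intWW)
      show "W s \<omega> * W t \<omega> \<le> ((W s \<omega>)\<^sup>2 + (W t \<omega>)\<^sup>2) / 2" for \<omega>
        using sum_squares_bound[of "W s \<omega>" "W t \<omega>"] by (simp add: mult.assoc mult.commute[of 2])
    qed (use square in auto)
    also have "\<dots> \<le> C" using square bound[of s] bound[of t] by simp
    finally show ?thesis using zero_le_power2[of a] unfolding ceq by linarith
  qed
  have row: "(\<Sum>t=1..n. ?c s t) \<le> 2 * (real m + 1) * C" for s
  proof -
    have "?c s t \<le> (if t \<in> {s - m..s + m} then C else 0)" for t
      using near[of s t] separated[of s t] by (auto simp: ceq not_le less_diff_conv)
    then have "(\<Sum>t=1..n. ?c s t) \<le> (\<Sum>t=1..n. if t \<in> {s - m..s + m} then C else 0)"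
      by (intro sum_mono)
    also have "\<dots> = real (card ({1..n} \<inter> {s - m..s + m})) * C"
      by (subst sum.inter_restrict[symmetric]) simp_all
    also have "\<dots> \<le> (2 * (real m + 1)) * C"
    proof (intro mult_right_mono C0)
      have "card ({1..n} \<inter> {s - m..s + m}) \<le> card {s - m..s + m}" by (intro card_mono) auto
      also have "\<dots> \<le> 2 * (m + 1)" by simp
      finally have "real (card ({1..n} \<inter> {s - m..s + m})) \<le> real (2 * (m + 1))" by (rule of_nat_mono)
      then show "real (card ({1..n} \<inter> {s - m..s + m})) \<le> 2 * (real m + 1)" by simp
    qed
    finally show ?thesis .
  qed
  show "expectation (\<lambda>\<omega>. \<bar>(\<Sum>t=1..n. W t \<omega>) / real n - a\<bar>) \<le> sqrt (2 * (real m + 1) * C / real n)"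
    if "0 < n"
  proof -
    note False = that
    have sq: "(\<bar>(\<Sum>t=1..n. W t \<omega>) / real n - a\<bar>)\<^sup>2
        = (\<Sum>s=1..n. \<Sum>t=1..n. (W s \<omega> - a) * (W t \<omega> - a)) / (real n)\<^sup>2" for \<omega>
    proof -
      have "(\<Sum>t=1..n. W t \<omega>) / real n - a = (\<Sum>t=1..n. W t \<omega> - a) / real n"
        using False by (simp add: sum_subtractf diff_divide_distrib)
      then show ?thesis
        by (simp add: power_divide power2_eq_square sum_product)
    qed
    have "(expectation (\<lambda>\<omega>. \<bar>(\<Sum>t=1..n. W t \<omega>) / real n - a\<bar>))\<^sup>2
        \<le> expectation (\<lambda>\<omega>. (\<bar>(\<Sum>t=1..n. W t \<omega>) / real n - a\<bar>)\<^sup>2)"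
    proof (rule expectation_power2_le(2))
      show "integrable M (\<lambda>\<omega>. (\<bar>(\<Sum>t=1..n. W t \<omega>) / real n - a\<bar>)\<^sup>2)"
        unfolding sq using intc by auto
    qed measurable
    also have "\<dots> = (\<Sum>s=1..n. \<Sum>t=1..n. ?c s t) / (real n)\<^sup>2"
      unfolding sq using intc by (simp add: Bochner_Integration.integral_sum)
    also have "\<dots> \<le> (\<Sum>s=1..n. 2 * (real m + 1) * C) / (real n)\<^sup>2"
      by (intro divide_right_mono sum_mono row) simp
    also have "\<dots> = 2 * (real m + 1) * C / real n"
      using False by (simp add: power2_eq_square)
    finally show ?thesis by (rule real_le_rsqrt)
  qed
qed

context gaussian_noise
begin

lemma noise_moments:
  "integrable M (\<lambda>\<omega>. (\<eta> t \<omega>)\<^sup>2)" "expectation (\<lambda>\<omega>. (\<eta> t \<omega>)\<^sup>2) = 1" "expectation (\<eta> t) = 0"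
proof -
  show "expectation (\<eta> t) = 0" by (rule standard_normal_distributed_expectation[OF std_normal])
  then show "expectation (\<lambda>\<omega>. (\<eta> t \<omega>)\<^sup>2) = 1"
    using standard_normal_distributed_variance[OF std_normal, of t] by simp
  show "integrable M (\<lambda>\<omega>. (\<eta> t \<omega>)\<^sup>2)"
    using distributed_integrable[OF std_normal[of t], of power2] integrable_std_normal_moment[of 2] by simp
qed

lemma indep_noise_backward: "indep_vars (\<lambda>_. borel) (\<lambda>j::nat. \<eta> (t - int j)) UNIV"
  by (rule indep_vars_reindex[where X=\<eta>]) (auto simp: inj_on_def intro: indep_vars_subset[OF indep_noise])

lemma AE_summable_linear:
  assumes "summable (\<lambda>j. (\<psi> j)\<^sup>2)"
  shows "AE \<omega> in M. summable (\<lambda>j. \<psi> j * \<eta> (t - int j) \<omega>)"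
proof -
  interpret independent_centered M "\<lambda>j \<omega>. \<psi> j * \<eta> (t - int j) \<omega>"
  proof
    show "indep_vars (\<lambda>_. borel) (\<lambda>j \<omega>. \<psi> j * \<eta> (t - int j) \<omega>) UNIV"
      by (rule indep_vars_compose2[OF indep_noise_backward]) auto
  qed (simp_all add: noise_moments power_mult_distrib)
  show ?thesis
    by (rule AE_summable) (simp add: power_mult_distrib noise_moments assms)
qed

text \<open>
  Expanding the square gives three log-normal moments. Writing \<open>p\<close> for the partial sums of \<open>\<psi>\<^sup>2\<close>, their
  exponents are \<open>8 p\<^sub>m\<close>, \<open>8 p\<^sub>k\<close> and, for the mixed term with coefficients \<open>4 \<psi>\<close> up to \<open>m\<close> and \<open>2 \<psi>\<close> beyond,
  \<open>8 p\<^sub>m + 2 (p\<^sub>k - p\<^sub>m)\<close>.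
\<close>

lemma filtered_difference_moment:
  fixes \<psi> :: "nat \<Rightarrow> real"
  assumes sm: "summable (\<lambda>j. (\<psi> j)\<^sup>2)" and mk: "m \<le> k"
  defines "c \<equiv> \<lambda>j. 2 * \<psi> j" and "v \<equiv> \<Sum>j. (\<psi> j)\<^sup>2"
  shows "integrable M (\<lambda>\<omega>. (exp (filtered c m t \<omega>) - exp (filtered c k t \<omega>))\<^sup>2)"
    and "expectation (\<lambda>\<omega>. (exp (filtered c m t \<omega>) - exp (filtered c k t \<omega>))\<^sup>2)
      \<le> exp (8 * v) * (exp (8 * (v - (\<Sum>j<m. (\<psi> j)\<^sup>2))) - 1)"
proof -
  define d where "d j = (if j < m then 4 * \<psi> j else 2 * \<psi> j)" for j
  have split: "(\<Sum>j<k. f j) = (\<Sum>j<m. f j) + (\<Sum>j\<in>{m..<k}. f j)" for f :: "nat \<Rightarrow> real"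
    using mk by (metis add.commute atLeast0LessThan sum.atLeastLessThan_concat zero_le)
  have mix: "filtered c m t \<omega> + filtered c k t \<omega> = filtered d k t \<omega>" for \<omega>
    unfolding filtered_def split[of "\<lambda>j. c j * \<eta> (t - int j) \<omega>"] split[of "\<lambda>j. d j * \<eta> (t - int j) \<omega>"]
    by (simp add: c_def d_def sum.distrib[symmetric] add.assoc[symmetric] mult.assoc)
  have dbl: "2 * filtered c n t \<omega> = filtered (\<lambda>j. 4 * \<psi> j) n t \<omega>" for n \<omega>
    unfolding filtered_def c_def sum_distrib_left by (intro sum.cong) auto
  have sq: "(exp (filtered c m t \<omega>) - exp (filtered c k t \<omega>))\<^sup>2
      = exp (filtered (\<lambda>j. 4 * \<psi> j) m t \<omega>) + exp (filtered (\<lambda>j. 4 * \<psi> j) k t \<omega>) - 2 * exp (filtered d k t \<omega>)" for \<omega>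
    unfolding dbl[symmetric] mix[symmetric] by (simp add: power2_diff exp_double exp_add)
  show "integrable M (\<lambda>\<omega>. (exp (filtered c m t \<omega>) - exp (filtered c k t \<omega>))\<^sup>2)"
    unfolding sq using filtered_exp_moment(1) by auto
  define p where "p n = (\<Sum>j<n. (\<psi> j)\<^sup>2)" for n
  have p4: "(\<Sum>j<n. (4 * \<psi> j)\<^sup>2) / 2 = 8 * p n" for n
    by (simp add: p_def power_mult_distrib sum_distrib_left[symmetric])
  have "(\<Sum>j<k. (d j)\<^sup>2) = 16 * p m + 4 * (\<Sum>j\<in>{m..<k}. (\<psi> j)\<^sup>2)"
    unfolding split by (simp add: p_def d_def power_mult_distrib sum_distrib_left)
  also have "(\<Sum>j\<in>{m..<k}. (\<psi> j)\<^sup>2) = p k - p m"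
    unfolding p_def split by simp
  finally have pd: "(\<Sum>j<k. (d j)\<^sup>2) / 2 = 8 * p m + 2 * (p k - p m)" by simp
  have mono: "p m \<le> p k" "p k \<le> v" "0 \<le> p m"
    using mk sm unfolding p_def v_def by (auto intro!: sum_mono2 sum_le_suminf sum_nonneg)
  have "expectation (\<lambda>\<omega>. (exp (filtered c m t \<omega>) - exp (filtered c k t \<omega>))\<^sup>2)
      = exp (8 * p m) + exp (8 * p k) - 2 * exp (8 * p m + 2 * (p k - p m))"
  proof -
    have e4: "expectation (\<lambda>\<omega>. exp (filtered (\<lambda>j. 4 * \<psi> j) n t \<omega>)) = exp (8 * p n)" for n
      by (simp only: filtered_exp_moment(2) p4)
    have ed: "expectation (\<lambda>\<omega>. exp (filtered d k t \<omega>)) = exp (8 * p m + 2 * (p k - p m))"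
      by (simp only: filtered_exp_moment(2) pd)
    show ?thesis unfolding sq using filtered_exp_moment(1) by (simp add: e4 ed)
  qed
  also have "\<dots> \<le> exp (8 * p k) - exp (8 * p m)"
    using mono by simp
  also have "\<dots> = exp (8 * p m) * (exp (8 * (p k - p m)) - 1)"
    by (simp add: algebra_simps exp_add[symmetric])
  also have "\<dots> \<le> exp (8 * v) * (exp (8 * (v - p m)) - 1)"
    using mono by (intro mult_mono) auto
  finally show "expectation (\<lambda>\<omega>. (exp (filtered c m t \<omega>) - exp (filtered c k t \<omega>))\<^sup>2)
      \<le> exp (8 * v) * (exp (8 * (v - (\<Sum>j<m. (\<psi> j)\<^sup>2))) - 1)" by (simp add: p_def)
qed

lemma log_volatility_measurable [measurable]: "log_volatility \<psi> \<eta> t \<in> borel_measurable M"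
  unfolding log_volatility_def by measurable

lemma filtered_tendsto_log_volatility:
  assumes "summable (\<lambda>j. (\<psi> j)\<^sup>2)"
  shows "AE \<omega> in M. (\<lambda>k. exp (filtered (\<lambda>j. 2 * \<psi> j) k t \<omega>)) \<longlonglongrightarrow> exp (2 * log_volatility \<psi> \<eta> t \<omega>)"
  using AE_summable_linear[OF assms, of t]
proof eventually_elim
  case (elim \<omega>)
  have "(\<lambda>k. 2 * (\<Sum>j<k. \<psi> j * \<eta> (t - int j) \<omega>)) \<longlonglongrightarrow> 2 * log_volatility \<psi> \<eta> t \<omega>"
    using summable_LIMSEQ[OF elim] unfolding log_volatility_def by (intro tendsto_mult_left)
  then show ?case unfolding filtered_def by (intro tendsto_exp) (simp add: sum_distrib_left mult.assoc)
qed

text \<open>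
  Fatou's lemma carries the second-moment estimate for two finite averages over to the limit of the longer
  one. The bound does not depend on \<open>t\<close> and tends to 0 as \<open>m\<close> grows.
\<close>

lemma squared_volatility_approximation:
  fixes \<psi> :: "nat \<Rightarrow> real"
  assumes sm: "summable (\<lambda>j. (\<psi> j)\<^sup>2)"
  defines "v \<equiv> \<Sum>j. (\<psi> j)\<^sup>2"
  shows "integrable M (\<lambda>\<omega>. exp (2 * log_volatility \<psi> \<eta> t \<omega>))"
    and "expectation (\<lambda>\<omega>. \<bar>exp (filtered (\<lambda>j. 2 * \<psi> j) m t \<omega>) - exp (2 * log_volatility \<psi> \<eta> t \<omega>)\<bar>)
      \<le> sqrt (exp (8 * v) * (exp (8 * (v - (\<Sum>j<m. (\<psi> j)\<^sup>2))) - 1))"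
proof -
  let ?A = "\<lambda>m \<omega>. exp (filtered (\<lambda>j. 2 * \<psi> j) m t \<omega>)" and ?S = "\<lambda>\<omega>. exp (2 * log_volatility \<psi> \<eta> t \<omega>)"
  have approx: "integrable M (\<lambda>\<omega>. \<bar>?A m \<omega> - ?S \<omega>\<bar>) \<and> expectation (\<lambda>\<omega>. \<bar>?A m \<omega> - ?S \<omega>\<bar>)
      \<le> sqrt (exp (8 * v) * (exp (8 * (v - (\<Sum>j<m. (\<psi> j)\<^sup>2))) - 1))" for m
  proof -
    define \<delta> where "\<delta> = exp (8 * v) * (exp (8 * (v - (\<Sum>j<m. (\<psi> j)\<^sup>2))) - 1)"
    have "(\<Sum>j<m. (\<psi> j)\<^sup>2) \<le> v" unfolding v_def by (intro sum_le_suminf sm) auto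
    then have \<delta>0: "0 \<le> \<delta>" by (simp add: \<delta>_def)
    have "(\<integral>\<^sup>+\<omega>. ennreal ((?A m \<omega> - ?S \<omega>)\<^sup>2) \<partial>M) = (\<integral>\<^sup>+\<omega>. liminf (\<lambda>k. ennreal ((?A m \<omega> - ?A k \<omega>)\<^sup>2)) \<partial>M)"
      using filtered_tendsto_log_volatility[OF sm, of t]
    proof (intro nn_integral_cong_AE, eventually_elim)
      case (elim \<omega>)
      have "(\<lambda>k. ennreal ((?A m \<omega> - ?A k \<omega>)\<^sup>2)) \<longlonglongrightarrow> ennreal ((?A m \<omega> - ?S \<omega>)\<^sup>2)"
        by (intro tendsto_intros tendsto_ennrealI elim)
      then show ?case using lim_imp_Liminf[OF sequentially_bot] by metis
    qed
    also have "\<dots> \<le> liminf (\<lambda>k. \<integral>\<^sup>+\<omega>. ennreal ((?A m \<omega> - ?A k \<omega>)\<^sup>2) \<partial>M)"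
      by (rule nn_integral_liminf) measurable
    also have "\<dots> \<le> ennreal \<delta>"
    proof (rule order_trans[OF Liminf_mono])
      show "\<forall>\<^sub>F k in sequentially. (\<integral>\<^sup>+\<omega>. ennreal ((?A m \<omega> - ?A k \<omega>)\<^sup>2) \<partial>M) \<le> ennreal \<delta>"
        using eventually_ge_at_top[of m]
      proof eventually_elim
        case (elim k)
        note d = filtered_difference_moment[OF sm elim, of t]
        show ?case using d by (subst nn_integral_eq_integral) (auto simp: \<delta>_def v_def intro: ennreal_leI)
      qed
    qed (simp add: Liminf_const)
    finally have le: "(\<integral>\<^sup>+\<omega>. ennreal ((?A m \<omega> - ?S \<omega>)\<^sup>2) \<partial>M) \<le> ennreal \<delta>" .
    have int: "integrable M (\<lambda>\<omega>. (?A m \<omega> - ?S \<omega>)\<^sup>2)"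
      using le by (intro integrableI_bounded) (auto intro: le_less_trans)
    have "ennreal (expectation (\<lambda>\<omega>. (?A m \<omega> - ?S \<omega>)\<^sup>2)) \<le> ennreal \<delta>"
      using le int by (subst (asm) nn_integral_eq_integral) auto
    then have "expectation (\<lambda>\<omega>. (?A m \<omega> - ?S \<omega>)\<^sup>2) \<le> \<delta>" using \<delta>0 by (simp add: ennreal_le_iff)
    moreover have "integrable M (\<lambda>\<omega>. (\<bar>?A m \<omega> - ?S \<omega>\<bar>)\<^sup>2)" using int by simp
    note e = expectation_power2_le[OF _ this]
    have "(expectation (\<lambda>\<omega>. \<bar>?A m \<omega> - ?S \<omega>\<bar>))\<^sup>2 \<le> expectation (\<lambda>\<omega>. (\<bar>?A m \<omega> - ?S \<omega>\<bar>)\<^sup>2)"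
      by (rule e(2)) measurable
    ultimately have "(expectation (\<lambda>\<omega>. \<bar>?A m \<omega> - ?S \<omega>\<bar>))\<^sup>2 \<le> \<delta>" by simp
    moreover have "integrable M (\<lambda>\<omega>. \<bar>?A m \<omega> - ?S \<omega>\<bar>)" by (rule e(1)) measurable
    ultimately show ?thesis unfolding \<delta>_def[symmetric] by (intro conjI real_le_rsqrt)
  qed
  then show "expectation (\<lambda>\<omega>. \<bar>?A m \<omega> - ?S \<omega>\<bar>) \<le> sqrt (exp (8 * v) * (exp (8 * (v - (\<Sum>j<m. (\<psi> j)\<^sup>2))) - 1))"
    by blast
  have "integrable M (\<lambda>\<omega>. \<bar>?A 0 \<omega> - ?S \<omega>\<bar>)" using approx by blast
  then have "integrable M (\<lambda>\<omega>. ?A 0 \<omega> - ?S \<omega>)" by (subst (asm) integrable_abs_iff) measurable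
  then have "integrable M (\<lambda>\<omega>. ?A 0 \<omega> - (?A 0 \<omega> - ?S \<omega>))"
    by (rule Bochner_Integration.integrable_diff[OF filtered_exp_moment(1)])
  moreover have "?S = (\<lambda>\<omega>. ?A 0 \<omega> - (?A 0 \<omega> - ?S \<omega>))" by (simp add: fun_eq_iff)
  ultimately show "integrable M ?S" by (simp only:)
qed

text \<open>
  Cutting the filter off after \<open>m\<close> terms changes the average by a small amount in \<open>L\<^sup>1\<close>, uniformly in \<open>n\<close>, and
  leaves a sequence of finite dependence range to which the covariance bound applies. The limit is the
  second moment of the log-normal volatility.
\<close>

theorem squared_volatility_weak_law:
  fixes \<psi> :: "nat \<Rightarrow> real"
  assumes sm: "summable (\<lambda>j. (\<psi> j)\<^sup>2)"
  defines "v \<equiv> \<Sum>j. (\<psi> j)\<^sup>2"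
  shows "(\<lambda>n. expectation (\<lambda>\<omega>. \<bar>(\<Sum>t=1..n. exp (2 * log_volatility \<psi> \<eta> (int t) \<omega>)) / real n - exp (2 * v)\<bar>)) \<longlonglongrightarrow> 0"
    (is "(\<lambda>n. ?E n) \<longlonglongrightarrow> 0")
proof (rule tendstoI)
  fix r :: real assume r: "r > 0"
  define p where "p m = (\<Sum>j<m. (\<psi> j)\<^sup>2)" for m
  let ?\<delta> = "\<lambda>m. sqrt (exp (8 * v) * (exp (8 * (v - p m)) - 1))"
  have p: "p \<longlonglongrightarrow> v" unfolding p_def v_def by (rule summable_LIMSEQ[OF sm])
  have "(\<lambda>m. ?\<delta> m + \<bar>exp (2 * p m) - exp (2 * v)\<bar>) \<longlonglongrightarrow>
      sqrt (exp (8 * v) * (exp (8 * (v - v)) - 1)) + \<bar>exp (2 * v) - exp (2 * v)\<bar>"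
    by (intro tendsto_intros p)
  then have "(\<lambda>m. ?\<delta> m + \<bar>exp (2 * p m) - exp (2 * v)\<bar>) \<longlonglongrightarrow> 0" by simp
  then have "\<forall>\<^sub>F m in sequentially. ?\<delta> m + \<bar>exp (2 * p m) - exp (2 * v)\<bar> < r / 2"
    using r by (intro order_tendstoD) auto
  then obtain m where m: "?\<delta> m + \<bar>exp (2 * p m) - exp (2 * v)\<bar> < r / 2"
    by (auto simp: eventually_sequentially)
  let ?c = "\<lambda>j. 2 * \<psi> j"
  let ?W = "\<lambda>t \<omega>. exp (filtered ?c m (int t) \<omega>)" and ?S = "\<lambda>t \<omega>. exp (2 * log_volatility \<psi> \<eta> (int t) \<omega>)"
  define C where "C = exp (8 * p m)"
  have W2: "(?W t \<omega>)\<^sup>2 = exp (filtered (\<lambda>j. 4 * \<psi> j) m (int t) \<omega>)" for t \<omega>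
    by (simp add: exp_double[symmetric] filtered_def sum_distrib_left mult.assoc)
  have p2': "(\<Sum>j<m. 4 * (\<psi> j)\<^sup>2) = 4 * p m" and p4': "(\<Sum>j<m. 16 * (\<psi> j)\<^sup>2) = 16 * p m"
    by (simp_all add: p_def sum_distrib_left)
  have sep: "expectation (\<lambda>\<omega>. ?W s \<omega> * ?W t \<omega>) = (exp (2 * p m))\<^sup>2" if "s + m < t \<or> t + m < s" for s t
  proof -
    have "int m \<le> \<bar>int s - int t\<bar>" using that by auto
    then show ?thesis by (subst filtered_exp_moment_separated(2)) (simp_all add: p2' power_mult_distrib exp_double[symmetric])
  qed
  note wl = weak_law_finite_range[where W="?W" and C=C and a="exp (2 * p m)" and m=m,
      unfolded W2, OF _ filtered_exp_moment(1) _ _ sep]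
  have wl1: "expectation (\<lambda>\<omega>. \<bar>(\<Sum>t=1..n. ?W t \<omega>) / real n - exp (2 * p m)\<bar>) \<le> sqrt (2 * (real m + 1) * C / real n)"
    if "0 < n" for n
    using that by (intro wl(1)) (simp_all add: filtered_exp_moment(2) power_mult_distrib p2' p4' C_def)
  have wl2: "integrable M (\<lambda>\<omega>. \<bar>(\<Sum>t=1..n. ?W t \<omega>) / real n - exp (2 * p m)\<bar>)" for n
    by (intro wl(2)) (simp_all add: filtered_exp_moment(2) power_mult_distrib p2' p4' C_def)
  have intS: "integrable M (?S t)" for t by (rule squared_volatility_approximation[OF sm])
  have bound: "?E n \<le> r / 2 + sqrt (2 * (real m + 1) * C / real n)" if n: "0 < n" for n
  proof -
    let ?R = "\<lambda>\<omega>. (\<Sum>t=1..n. \<bar>?W t \<omega> - ?S t \<omega>\<bar>) / real n + \<bar>(\<Sum>t=1..n. ?W t \<omega>) / real n - exp (2 * p m)\<bar>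
        + \<bar>exp (2 * p m) - exp (2 * v)\<bar>"
    have intd: "integrable M (\<lambda>\<omega>. \<bar>?W t \<omega> - ?S t \<omega>\<bar>)" for t
      by (intro integrable_abs Bochner_Integration.integrable_diff intS filtered_exp_moment(1))
    have intR: "integrable M (\<lambda>\<omega>. (\<Sum>t=1..n. \<bar>?W t \<omega> - ?S t \<omega>\<bar>) / real n)"
      by (intro integrable_divide Bochner_Integration.integrable_sum intd)
    have "?E n \<le> expectation ?R"
    proof (rule integral_mono)
      show "integrable M (\<lambda>\<omega>. \<bar>(\<Sum>t=1..n. ?S t \<omega>) / real n - exp (2 * v)\<bar>)"
        using intS by auto
      show "integrable M ?R" by (intro Bochner_Integration.integrable_add intR wl2) simp
      fix \<omega>
      have "\<bar>(\<Sum>t=1..n. ?S t \<omega>) / real n - (\<Sum>t=1..n. ?W t \<omega>) / real n\<bar> = \<bar>\<Sum>t=1..n. ?W t \<omega> - ?S t \<omega>\<bar> / real n"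
        by (simp add: sum_subtractf diff_divide_distrib[symmetric] abs_minus_commute)
      also have "\<dots> \<le> (\<Sum>t=1..n. \<bar>?W t \<omega> - ?S t \<omega>\<bar>) / real n"
        by (intro divide_right_mono sum_abs) simp
      finally show "\<bar>(\<Sum>t=1..n. ?S t \<omega>) / real n - exp (2 * v)\<bar> \<le> ?R \<omega>" by linarith
    qed
    also have "\<dots> = (\<Sum>t=1..n. expectation (\<lambda>\<omega>. \<bar>?W t \<omega> - ?S t \<omega>\<bar>)) / real n
        + expectation (\<lambda>\<omega>. \<bar>(\<Sum>t=1..n. ?W t \<omega>) / real n - exp (2 * p m)\<bar>) + \<bar>exp (2 * p m) - exp (2 * v)\<bar>"
      using intd intR wl2[of n] by (simp add: prob_space Bochner_Integration.integral_sum)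
    also have "\<dots> \<le> (\<Sum>t=1..n. ?\<delta> m) / real n + sqrt (2 * (real m + 1) * C / real n) + \<bar>exp (2 * p m) - exp (2 * v)\<bar>"
      using squared_volatility_approximation(2)[OF sm, of m] wl1[OF n]
      by (intro add_mono divide_right_mono sum_mono) (auto simp: v_def p_def)
    also have "(\<Sum>t=1..n. ?\<delta> m) / real n = ?\<delta> m" using n by simp
    finally show ?thesis using m by linarith
  qed
  have "(\<lambda>n. sqrt (2 * (real m + 1) * C / real n)) \<longlonglongrightarrow> sqrt 0"
    by (intro tendsto_real_sqrt lim_const_over_n)
  then have "\<forall>\<^sub>F n in sequentially. sqrt (2 * (real m + 1) * C / real n) < r / 2"
    using r by (intro order_tendstoD) auto
  then show "\<forall>\<^sub>F n in sequentially. dist (?E n) 0 < r"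
    using eventually_gt_at_top[of 0]
  proof eventually_elim
    case (elim n)
    have "0 \<le> ?E n" by simp
    then show ?case using bound[OF elim(2)] elim(1) by (simp only: dist_real_def abs_of_nonneg diff_0_right)
  qed
qed

text \<open>
  The log-volatility at every time is the same functional of the reversed noise sequence seen from that
  time, and all these sequences have the same product law.
\<close>

lemma distr_log_volatility:
  "distr M borel (log_volatility \<psi> \<eta> t) = distr M borel (log_volatility \<psi> \<eta> 0)"
proof -
  have d: "distr M borel (\<eta> s) = density lborel std_normal_density" for s
    using distributed_distr_eq_density[OF std_normal[of s]] by (simp cong: distr_cong)
  let ?F = "\<lambda>x. \<Sum>j. \<psi> j * x j"
  let ?P = "PiM UNIV (\<lambda>_::nat. borel :: real measure)"
  have F[measurable]: "?F \<in> borel_measurable ?P" by measurable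
  have seq: "distr M ?P (\<lambda>\<omega> j. \<eta> (s - int j) \<omega>) = PiM UNIV (\<lambda>_. density lborel std_normal_density)" for s
    using indep_noise_backward[of s] indep_vars_iff_distr_eq_PiM[where I=UNIV and M'="\<lambda>_. borel" and X="\<lambda>j::nat. \<eta> (s - int j)"]
    by (simp add: d restrict_UNIV)
  have "distr M borel (log_volatility \<psi> \<eta> s) = distr (distr M ?P (\<lambda>\<omega> j. \<eta> (s - int j) \<omega>)) borel ?F" for s
    by (subst distr_distr) (auto simp: log_volatility_def comp_def intro!: distr_cong measurable_PiM_single')
  then show ?thesis by (simp add: seq)
qed

end

section \<open>Products of characteristic functions with random weights\<close>

lemma exp_neg_half_lipschitz:
  fixes x y :: real
  assumes "0 \<le> x" "0 \<le> y"
  shows "\<bar>exp (- x / 2) - exp (- y / 2)\<bar> \<le> \<bar>x - y\<bar>"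
  using assms
proof (induction x y rule: linorder_wlog)
  case (le x y)
  define d where "d = (y - x) / 2"
  have d: "0 \<le> d" "d \<le> y - x" using le by (auto simp: d_def)
  have "exp (- x / 2) - exp (- y / 2) = exp (- x / 2) * (1 - exp (- d))"
    by (simp add: right_diff_distrib exp_add[symmetric] d_def field_simps)
  also have "\<dots> \<le> 1 * (1 - exp (- d))" using le d by (intro mult_right_mono) auto
  also have "\<dots> \<le> y - x" using exp_ge_add_one_self[of "- d"] d by simp
  finally show ?case using le by simp
qed (simp add: abs_minus_commute)

context square_tail_distribution
begin

lemma H_measurable [measurable]: "H \<in> borel_measurable borel"
  unfolding truncated_second_moment_def by measurable

lemma D_measurable [measurable]: "D \<in> borel_measurable borel"
  unfolding D_def by measurable

lemma H_ratio_le: "H (c * s) / H s \<le> max (c\<^sup>2) 1"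
proof (cases "s = 0")
  case False
  then show ?thesis using H_scale_le[of c s] H_pos[of s] by (simp add: pos_divide_le_eq)
qed simp

text \<open>
  Regular variation gives convergence for each value of \<open>V\<close>, and the bound \<open>H(cs)/H(s) \<le> max c\<^sup>2 1\<close>
  provides an integrable majorant.
\<close>

lemma H_ratio_L1:
  assumes N: "prob_space N" and [measurable]: "V \<in> borel_measurable N"
    and V2: "integrable N (\<lambda>\<omega>. (V \<omega>)\<^sup>2)" and s: "filterlim s (at 0) sequentially"
  shows "(\<lambda>n. \<integral>\<omega>. \<bar>H (V \<omega> * s n) / H (s n) - (V \<omega>)\<^sup>2\<bar> \<partial>N) \<longlonglongrightarrow> 0"
proof -
  interpret N: prob_space N by fact
  have aux: "\<bar>r - w\<bar> \<le> 2 * w + 1" if "0 \<le> r" "r \<le> max w 1" "0 \<le> w" for r w :: real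
    using that by (auto simp: abs_le_iff max_def split: if_splits)
  have "(\<lambda>n. \<integral>\<omega>. \<bar>H (V \<omega> * s n) / H (s n) - (V \<omega>)\<^sup>2\<bar> \<partial>N) \<longlonglongrightarrow> (\<integral>\<omega>. 0 \<partial>N)"
  proof (rule integral_dominated_convergence[where w="\<lambda>\<omega>. 2 * (V \<omega>)\<^sup>2 + 1"])
    show "integrable N (\<lambda>\<omega>. 2 * (V \<omega>)\<^sup>2 + 1)" using V2 by simp
    show "AE \<omega> in N. (\<lambda>n. \<bar>H (V \<omega> * s n) / H (s n) - (V \<omega>)\<^sup>2\<bar>) \<longlonglongrightarrow> 0"
      by (intro AE_I2 tendsto_rabs_zero LIM_zero filterlim_compose[OF H_regular s])
    show "AE \<omega> in N. norm \<bar>H (V \<omega> * s n) / H (s n) - (V \<omega>)\<^sup>2\<bar> \<le> 2 * (V \<omega>)\<^sup>2 + 1" for n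
    proof (rule AE_I2)
      fix \<omega>
      have "0 \<le> H (V \<omega> * s n) / H (s n)" by simp
      then show "norm \<bar>H (V \<omega> * s n) / H (s n) - (V \<omega>)\<^sup>2\<bar> \<le> 2 * (V \<omega>)\<^sup>2 + 1"
        using aux[OF _ H_ratio_le zero_le_power2] by simp
    qed
  qed measurable
  then show ?thesis by simp
qed

lemma D_ratio_L1:
  assumes N: "prob_space N" and [measurable]: "V \<in> borel_measurable N"
    and V2: "integrable N (\<lambda>\<omega>. (V \<omega>)\<^sup>2)" and s: "filterlim s (at 0) sequentially"
  shows "(\<lambda>n. \<integral>\<omega>. D (V \<omega> * s n) / H (s n) \<partial>N) \<longlonglongrightarrow> 0"
proof -
  interpret N: prob_space N by fact
  obtain C where C: "0 \<le> C" "\<And>s. D s \<le> C * H s" by (rule D_dominated) blast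
  have "(\<lambda>n. \<integral>\<omega>. D (V \<omega> * s n) / H (s n) \<partial>N) \<longlonglongrightarrow> (\<integral>\<omega>. 0 \<partial>N)"
  proof (rule integral_dominated_convergence[where w="\<lambda>\<omega>. C * ((V \<omega>)\<^sup>2 + 1)"])
    show "integrable N (\<lambda>\<omega>. C * ((V \<omega>)\<^sup>2 + 1))" using V2 by simp
    have "((\<lambda>s. D (c * s) / H s) \<longlongrightarrow> 0) (at 0)" for c
    proof (cases "c = 0")
      case False
      have "((\<lambda>s. D (c * s) / H (c * s) * (H (c * s) / H s)) \<longlongrightarrow> 0 * c\<^sup>2) (at 0)"
        by (intro tendsto_mult H_regular filterlim_compose[OF D_negligible filterlim_scale_at_0] False)
      moreover have cancel: "b \<noteq> 0 \<Longrightarrow> a / b * (b / d) = a / d" for a b d :: real by simp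
      have "\<forall>\<^sub>F s in at 0. D (c * s) / H (c * s) * (H (c * s) / H s) = D (c * s) / H s"
      proof -
        have "D (c * s) / H (c * s) * (H (c * s) / H s) = D (c * s) / H s" if "s \<noteq> 0" for s
        proof -
          have "H (c * s) \<noteq> 0" using False that by (metis H_pos less_irrefl mult_eq_0_iff)
          then show ?thesis by (rule cancel)
        qed
        then show ?thesis unfolding eventually_at by (intro exI[of _ 1]) auto
      qed
      ultimately show ?thesis by (subst (asm) tendsto_cong) simp_all
    qed (use C(2)[of 0] D_nonneg[of 0] in simp)
    then show "AE \<omega> in N. (\<lambda>n. D (V \<omega> * s n) / H (s n)) \<longlonglongrightarrow> 0"
      by (intro AE_I2 filterlim_compose[OF _ s])
    show "AE \<omega> in N. norm (D (V \<omega> * s n) / H (s n)) \<le> C * ((V \<omega>)\<^sup>2 + 1)" for n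
    proof (rule AE_I2)
      fix \<omega>
      have "D (V \<omega> * s n) / H (s n) \<le> C * H (V \<omega> * s n) / H (s n)"
        by (intro divide_right_mono C) simp
      also have "\<dots> = C * (H (V \<omega> * s n) / H (s n))" by simp
      also have "\<dots> \<le> C * ((V \<omega>)\<^sup>2 + 1)"
        by (intro mult_left_mono C(1) order_trans[OF H_ratio_le]) simp
      finally show "norm (D (V \<omega> * s n) / H (s n)) \<le> C * ((V \<omega>)\<^sup>2 + 1)" by simp
    qed
  qed measurable
  then show ?thesis by simp
qed

text \<open>
  The conditional central limit theorem behind the result, for random weights \<open>V\<^sub>t\<close> whose squares obey a law
  of large numbers. Three errors are made, each going to 0 in \<open>L\<^sup>1\<close>: replacing every factor of the product
  by an exponential costs \<open>n E[D]\<close>, replacing \<open>H\<close> by its regularly varying limit costs the \<open>L\<^sup>1\<close> error of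
  the ratio, and replacing the mean of the squares by \<open>K\<close> is the law of large numbers. Since \<open>n = 1/H(s\<^sub>n)\<close>,
  the first two are the quantities of the preceding lemmas.
\<close>

theorem expected_char_product_limit:
  fixes V :: "nat \<Rightarrow> 'b \<Rightarrow> real"
  assumes N: "prob_space N" and V[measurable]: "\<And>t. V t \<in> borel_measurable N"
    and ident: "\<And>t. distr N borel (V t) = distr N borel (V 0)"
    and V2: "integrable N (\<lambda>\<omega>. (V 0 \<omega>)\<^sup>2)" and K0: "0 \<le> K"
    and lln: "(\<lambda>n. \<integral>\<omega>. \<bar>(\<Sum>t=1..n. (V t \<omega>)\<^sup>2) / real n - K\<bar> \<partial>N) \<longlonglongrightarrow> 0"
    and s: "filterlim s (at 0) sequentially" and norming: "\<forall>\<^sub>F n in sequentially. real n * H (s n) = 1"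
  shows "(\<lambda>n. \<integral>\<omega>. (\<Prod>t=1..n. char \<mu> (u * V t \<omega> * s n)) \<partial>N) \<longlonglongrightarrow> exp (- of_real (u\<^sup>2 * K) / 2)"
proof -
  interpret N: prob_space N by fact
  have integral_by_law: "(\<integral>\<omega>. g (V t \<omega>) \<partial>N) = (\<integral>\<omega>. g (V 0 \<omega>) \<partial>N)"
    if [measurable]: "g \<in> borel_measurable borel" for g :: "real \<Rightarrow> real" and t
    using integral_distr[of "V t" N borel g] integral_distr[of "V 0" N borel g] ident[of t] by simp
  have integrable_by_law: "integrable N (\<lambda>\<omega>. g (V t \<omega>)) \<longleftrightarrow> integrable N (\<lambda>\<omega>. g (V 0 \<omega>))"
    if [measurable]: "g \<in> borel_measurable borel" for g :: "real \<Rightarrow> real" and t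
    using integrable_distr_eq[of "V t" N borel g] integrable_distr_eq[of "V 0" N borel g] ident[of t] by simp
  let ?W = "\<lambda>\<omega>. u * V 0 \<omega>"
  have W2: "integrable N (\<lambda>\<omega>. (?W \<omega>)\<^sup>2)" using V2 by (simp add: power_mult_distrib)
  define \<delta>1 where "\<delta>1 n = (\<integral>\<omega>. D (?W \<omega> * s n) / H (s n) \<partial>N)" for n
  define \<delta>2 where "\<delta>2 n = (\<integral>\<omega>. \<bar>H (?W \<omega> * s n) / H (s n) - (?W \<omega>)\<^sup>2\<bar> \<partial>N)" for n
  define \<delta>3 where "\<delta>3 n = (\<integral>\<omega>. \<bar>(\<Sum>t=1..n. (V t \<omega>)\<^sup>2) / real n - K\<bar> \<partial>N)" for n
  have lim: "\<delta>1 \<longlonglongrightarrow> 0" "\<delta>2 \<longlonglongrightarrow> 0" "\<delta>3 \<longlonglongrightarrow> 0"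
    unfolding \<delta>1_def \<delta>2_def \<delta>3_def
    by (intro D_ratio_L1 H_ratio_L1 N W2 s; measurable) (intro D_ratio_L1 H_ratio_L1 N W2 s lln; measurable)+
  let ?P = "\<lambda>n \<omega>. \<Prod>t=1..n. char \<mu> (u * V t \<omega> * s n)"
  let ?k = "exp (- of_real (u\<^sup>2 * K) / 2) :: complex"
  have bound: "cmod ((\<integral>\<omega>. ?P n \<omega> \<partial>N) - ?k) \<le> \<delta>1 n + \<delta>2 n + u\<^sup>2 * \<delta>3 n"
    if n: "real n * H (s n) = 1" for n
  proof -
    have n0: "n > 0" using n by (cases n) auto
    have Hn: "1 / H (s n) = real n" using n by (metis nonzero_eq_divide_eq mult_zero_right zero_neq_one)
    have intP: "integrable N (?P n)"
    proof (rule N.integrable_const_bound[where B=1])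
      show "AE \<omega> in N. norm (?P n \<omega>) \<le> 1"
        by (intro AE_I2) (auto simp: prod_norm[symmetric] cmod_char_le_1 intro!: prod_le_1)
    qed measurable
    let ?h = "\<lambda>t \<omega>. H (u * V t \<omega> * s n)"
    let ?R = "\<lambda>\<omega>. (\<Sum>t=1..n. D (u * V t \<omega> * s n)) + (\<Sum>t=1..n. \<bar>?h t \<omega> - (u * V t \<omega>)\<^sup>2 / real n\<bar>)
       + u\<^sup>2 * \<bar>(\<Sum>t=1..n. (V t \<omega>)\<^sup>2) / real n - K\<bar>"
    have pointwise: "cmod (?P n \<omega> - ?k) \<le> ?R \<omega>" for \<omega>
    proof -
      let ?E = "\<Prod>t=1..n. exp (- ?h t \<omega> / 2)"
      have "cmod (?P n \<omega> - of_real ?E) \<le> (\<Sum>t=1..n. cmod (char \<mu> (u * V t \<omega> * s n) - of_real (exp (- ?h t \<omega> / 2))))"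
        unfolding of_real_prod by (intro norm_prod_diff) (auto simp: cmod_char_le_1)
      then have 1: "cmod (?P n \<omega> - of_real ?E) \<le> (\<Sum>t=1..n. D (u * V t \<omega> * s n))"
        by (simp add: D_def exp_of_real[symmetric])
      have "?E = exp (- (\<Sum>t=1..n. ?h t \<omega>) / 2)"
        by (simp add: exp_sum[symmetric] sum_negf sum_divide_distrib)
      moreover have "\<bar>exp (- x / 2) - exp (- y / 2)\<bar> \<le> \<bar>x - y\<bar>" if "0 \<le> x" "0 \<le> y" for x y :: real
        using that by (rule exp_neg_half_lipschitz)
      ultimately have "\<bar>?E - exp (- (u\<^sup>2 * K) / 2)\<bar> \<le> \<bar>(\<Sum>t=1..n. ?h t \<omega>) - u\<^sup>2 * K\<bar>"
        using K0 by (simp add: sum_nonneg)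
      also have "(\<Sum>t=1..n. ?h t \<omega>) - u\<^sup>2 * K = (\<Sum>t=1..n. ?h t \<omega> - (u * V t \<omega>)\<^sup>2 / real n)
          + u\<^sup>2 * ((\<Sum>t=1..n. (V t \<omega>)\<^sup>2) / real n - K)"
        by (simp add: sum_subtractf sum_divide_distrib[symmetric] power_mult_distrib sum_distrib_left[symmetric] algebra_simps)
      also have "\<bar>\<dots>\<bar> \<le> (\<Sum>t=1..n. \<bar>?h t \<omega> - (u * V t \<omega>)\<^sup>2 / real n\<bar>) + u\<^sup>2 * \<bar>(\<Sum>t=1..n. (V t \<omega>)\<^sup>2) / real n - K\<bar>"
        by (rule order_trans[OF abs_triangle_ineq]) (intro add_mono sum_abs, simp add: abs_mult)
      finally have 2: "\<bar>?E - exp (- (u\<^sup>2 * K) / 2)\<bar> \<le> (\<Sum>t=1..n. \<bar>?h t \<omega> - (u * V t \<omega>)\<^sup>2 / real n\<bar>)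
          + u\<^sup>2 * \<bar>(\<Sum>t=1..n. (V t \<omega>)\<^sup>2) / real n - K\<bar>" .
      have "?k = of_real (exp (- (u\<^sup>2 * K) / 2))" by (simp add: exp_of_real[symmetric])
      then have "cmod (?P n \<omega> - ?k) \<le> cmod (?P n \<omega> - of_real ?E) + \<bar>?E - exp (- (u\<^sup>2 * K) / 2)\<bar>"
        using norm_triangle_ineq[of "?P n \<omega> - of_real ?E" "of_real ?E - ?k"]
        by (simp only: of_real_diff[symmetric] norm_of_real) simp
      then show ?thesis using 1 2 by linarith
    qed
    have iV: "integrable N (\<lambda>\<omega>. (V t \<omega>)\<^sup>2)" for t
      using integrable_by_law[of power2 t] V2 by simp
    have iD: "integrable N (\<lambda>\<omega>. D (u * V t \<omega> * s n))" for t
      by (rule N.integrable_const_bound[where B=2]) (auto simp: D_le_2)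
    have iH: "integrable N (\<lambda>\<omega>. \<bar>?h t \<omega> - (u * V t \<omega>)\<^sup>2 / real n\<bar>)" for t
    proof -
      have "integrable N (?h t)"
        by (rule N.integrable_const_bound[where B=1]) (auto simp: H_le_1)
      then show ?thesis using iV[of t] by (simp add: power_mult_distrib)
    qed
    have iL: "integrable N (\<lambda>\<omega>. \<bar>(\<Sum>t=1..n. (V t \<omega>)\<^sup>2) / real n - K\<bar>)"
      using iV by simp
    have "cmod ((\<integral>\<omega>. ?P n \<omega> \<partial>N) - ?k) = cmod (\<integral>\<omega>. ?P n \<omega> - ?k \<partial>N)"
      using intP by (simp add: N.prob_space)
    also have "\<dots> \<le> (\<integral>\<omega>. ?R \<omega> \<partial>N)"
      by (rule order_trans[OF integral_norm_bound], rule integral_mono)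
         (use intP iD iH iL pointwise in \<open>auto simp del: of_real_mult\<close>)
    also have "\<dots> = (\<Sum>t=1..n. \<integral>\<omega>. D (u * V t \<omega> * s n) \<partial>N)
        + (\<Sum>t=1..n. \<integral>\<omega>. \<bar>?h t \<omega> - (u * V t \<omega>)\<^sup>2 / real n\<bar> \<partial>N) + u\<^sup>2 * \<delta>3 n"
      using iD iH iL by (simp add: Bochner_Integration.integral_sum \<delta>3_def)
    also have "(\<Sum>t=1..n. \<integral>\<omega>. D (u * V t \<omega> * s n) \<partial>N) = real n * (\<integral>\<omega>. D (?W \<omega> * s n) \<partial>N)"
      by (subst integral_by_law[of "\<lambda>x. D (u * x * s n)"]) simp_all
    also have "\<dots> = \<delta>1 n"
      by (simp add: \<delta>1_def Hn[symmetric])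
    also have "(\<Sum>t=1..n. \<integral>\<omega>. \<bar>?h t \<omega> - (u * V t \<omega>)\<^sup>2 / real n\<bar> \<partial>N)
        = real n * (\<integral>\<omega>. \<bar>?h 0 \<omega> - (?W \<omega>)\<^sup>2 / real n\<bar> \<partial>N)"
      by (subst integral_by_law[of "\<lambda>x. \<bar>H (u * x * s n) - (u * x)\<^sup>2 / real n\<bar>"]) simp_all
    also have "\<dots> = (\<integral>\<omega>. real n * \<bar>?h 0 \<omega> - (?W \<omega>)\<^sup>2 / real n\<bar> \<partial>N)" by simp
    also have "\<dots> = \<delta>2 n"
      unfolding \<delta>2_def
    proof (rule Bochner_Integration.integral_cong[OF refl])
      fix \<omega>
      have "real n * \<bar>?h 0 \<omega> - (?W \<omega>)\<^sup>2 / real n\<bar> = \<bar>real n * (?h 0 \<omega> - (?W \<omega>)\<^sup>2 / real n)\<bar>"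
        by (simp add: abs_mult)
      also have "real n * (?h 0 \<omega> - (?W \<omega>)\<^sup>2 / real n) = ?h 0 \<omega> * (1 / H (s n)) - (?W \<omega>)\<^sup>2"
        unfolding Hn using n0 by (simp add: right_diff_distrib)
      finally show "real n * \<bar>?h 0 \<omega> - (?W \<omega>)\<^sup>2 / real n\<bar> = \<bar>?h 0 \<omega> / H (s n) - (?W \<omega>)\<^sup>2\<bar>" by simp
    qed
    finally show ?thesis .
  qed
  have "(\<lambda>n. (\<integral>\<omega>. ?P n \<omega> \<partial>N) - ?k) \<longlonglongrightarrow> 0"
  proof (rule Lim_null_comparison)
    show "\<forall>\<^sub>F n in sequentially. norm ((\<integral>\<omega>. ?P n \<omega> \<partial>N) - ?k) \<le> \<delta>1 n + \<delta>2 n + u\<^sup>2 * \<delta>3 n"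
      using norming by eventually_elim (rule bound)
    show "(\<lambda>n. \<delta>1 n + \<delta>2 n + u\<^sup>2 * \<delta>3 n) \<longlonglongrightarrow> 0"
      by (intro tendsto_add_zero tendsto_mult_right_zero lim)
  qed
  then show ?thesis by (rule LIM_zero_cancel)
qed

end

text \<open>
  Given \<open>V\<close>, the sum has independent summands with deterministic weights. As \<open>Z\<close> and \<open>V\<close> are independent as
  processes, their joint law is a product measure, and conditioning amounts to Fubini's theorem.
\<close>

lemma (in prob_space) expectation_iexp_random_weights:
  fixes Z V :: "int \<Rightarrow> 'a \<Rightarrow> real" and g :: "real \<Rightarrow> real"
  assumes Z: "indep_vars (\<lambda>_. borel) Z UNIV" and ident: "\<And>t. distr M borel (Z t) = \<mu>"
    and ind: "indep_var (\<Pi>\<^sub>M t\<in>UNIV. borel) (\<lambda>\<omega> t. Z t \<omega>) (\<Pi>\<^sub>M t\<in>UNIV. borel) (\<lambda>\<omega> t. V t \<omega>)"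
    and g[measurable]: "g \<in> borel_measurable borel" and I: "finite I"
  shows "(\<integral>\<omega>. iexp (\<Sum>t\<in>I. g (V t \<omega>) * Z t \<omega>) \<partial>M) = (\<integral>\<omega>. (\<Prod>t\<in>I. char \<mu> (g (V t \<omega>))) \<partial>M)"
proof -
  let ?P = "\<Pi>\<^sub>M t\<in>(UNIV::int set). (borel :: real measure)"
  let ?Z = "\<lambda>\<omega> t. Z t \<omega>" and ?V = "\<lambda>\<omega> t. V t \<omega>"
  let ?f = "\<lambda>z v. iexp (\<Sum>t\<in>I. g (v t) * z t)"
  have rv[measurable]: "?Z \<in> M \<rightarrow>\<^sub>M ?P" "?V \<in> M \<rightarrow>\<^sub>M ?P"
    using ind by (auto dest: indep_var_rv1 indep_var_rv2)
  have Zm[measurable]: "Z t \<in> borel_measurable M" for t using Z by (auto simp: indep_vars_def)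
  have prod: "distr M ?P ?Z \<Otimes>\<^sub>M distr M ?P ?V = distr M (?P \<Otimes>\<^sub>M ?P) (\<lambda>\<omega>. (?Z \<omega>, ?V \<omega>))"
    using ind unfolding indep_var_distribution_eq by simp
  interpret PZ: prob_space "distr M ?P ?Z" by (rule prob_space_distr) measurable
  interpret PV: prob_space "distr M ?P ?V" by (rule prob_space_distr) measurable
  interpret PP: pair_prob_space "distr M ?P ?Z" "distr M ?P ?V" ..
  have fm[measurable]: "(\<lambda>(z, v). ?f z v) \<in> borel_measurable (?P \<Otimes>\<^sub>M ?P)" by measurable
  have fint: "integrable (distr M ?P ?Z \<Otimes>\<^sub>M distr M ?P ?V) (\<lambda>(z, v). ?f z v)"
  proof (rule PP.integrable_const_bound[where B=1])
    show "(\<lambda>(z, v). ?f z v) \<in> borel_measurable (distr M ?P ?Z \<Otimes>\<^sub>M distr M ?P ?V)"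
      unfolding prod by simp
  qed (auto simp del: of_real_sum)
  have inner: "(\<integral>z. ?f z v \<partial>distr M ?P ?Z) = (\<Prod>t\<in>I. char \<mu> (g (v t)))" for v
  proof -
    have "(\<integral>z. ?f z v \<partial>distr M ?P ?Z) = (\<integral>\<omega>. ?f (?Z \<omega>) v \<partial>M)"
      by (rule integral_distr) measurable
    also have "\<dots> = char (distr M borel (\<lambda>\<omega>. \<Sum>t\<in>I. g (v t) * Z t \<omega>)) 1"
      unfolding char_def by (subst integral_distr) (simp_all del: of_real_sum)
    also have "\<dots> = (\<Prod>t\<in>I. char (distr M borel (\<lambda>\<omega>. g (v t) * Z t \<omega>)) 1)"
      by (rule char_distr_sum, rule indep_vars_compose2[OF indep_vars_subset[OF Z]]) auto
    also have "\<dots> = (\<Prod>t\<in>I. char \<mu> (g (v t)))"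
    proof (rule prod.cong[OF refl])
      fix t
      show "char (distr M borel (\<lambda>\<omega>. g (v t) * Z t \<omega>)) 1 = char \<mu> (g (v t))"
        unfolding ident[of t, symmetric] char_def by (subst (1 2) integral_distr) simp_all
    qed
    finally show ?thesis .
  qed
  have "(\<integral>\<omega>. iexp (\<Sum>t\<in>I. g (V t \<omega>) * Z t \<omega>) \<partial>M)
      = (\<integral>p. (case p of (z, v) \<Rightarrow> ?f z v) \<partial>distr M (?P \<Otimes>\<^sub>M ?P) (\<lambda>\<omega>. (?Z \<omega>, ?V \<omega>)))"
    by (subst integral_distr) simp_all
  also have "\<dots> = (\<integral>v. (\<integral>z. ?f z v \<partial>distr M ?P ?Z) \<partial>distr M ?P ?V)"
    unfolding prod[symmetric] by (rule PP.integral_snd[OF fint, symmetric])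
  also have "\<dots> = (\<integral>v. (\<Prod>t\<in>I. char \<mu> (g (v t))) \<partial>distr M ?P ?V)" unfolding inner ..
  also have "\<dots> = (\<integral>\<omega>. (\<Prod>t\<in>I. char \<mu> (g (V t \<omega>))) \<partial>M)"
  proof (rule integral_distr)
    interpret \<mu>: real_distribution \<mu>
      unfolding ident[of 0, symmetric] by (rule real_distribution_distr) measurable
    show "(\<lambda>v. \<Prod>t\<in>I. char \<mu> (g (v t))) \<in> borel_measurable ?P" by measurable
  qed measurable
  finally show ?thesis .
qed

section \<open>The limit of the normalized sums\<close>

lemma centered_normal_distribution:
  assumes s: "0 < s"
  shows "real_distribution (density lborel (normal_density 0 s))"
    and "char (density lborel (normal_density 0 s)) u = exp (- of_real (u\<^sup>2 * s\<^sup>2) / 2)"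
proof -
  interpret N: real_distribution std_normal_distribution by (rule real_dist_normal_dist)
  have "distributed std_normal_distribution lborel (\<lambda>x. x) std_normal_density"
    by (auto simp: distributed_def distr_id2)
  from N.normal_density_affine[OF this, of s 0]
  have d: "density lborel (normal_density 0 s) = distr std_normal_distribution borel (\<lambda>x. s * x)"
    using s distributed_distr_eq_density by (fastforce cong: distr_cong)
  show "real_distribution (density lborel (normal_density 0 s))"
    unfolding d by (rule N.real_distribution_distr) simp
  have "char (density lborel (normal_density 0 s)) u = char std_normal_distribution (u * s)"
    unfolding d char_def by (subst integral_distr) (simp_all add: mult.assoc)
  also have "\<dots> = exp (- of_real (u\<^sup>2 * s\<^sup>2) / 2)"
    by (simp add: char_std_normal_distribution exp_of_real[symmetric] power_mult_distrib)
  finally show "char (density lborel (normal_density 0 s)) u = exp (- of_real (u\<^sup>2 * s\<^sup>2) / 2)" .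
qed

theorem proposition3p6:
  fixes M :: "'a measure"
    and Z \<eta> :: "int \<Rightarrow> 'a \<Rightarrow> real"
    and \<psi> :: "nat \<Rightarrow> real"
    and a :: "nat \<Rightarrow> real"
  assumes "prob_space M"
    and "iid M Z"
    and "regularly_varying M (Z 0) 2"
    and "integrable M (Z 0)"
    and "(\<integral>\<omega>. Z 0 \<omega> \<partial>M) = 0"
    and "(\<integral>\<^sup>+\<omega>. ennreal ((Z 0 \<omega> - (\<integral>\<omega>'. Z 0 \<omega>' \<partial>M))\<^sup>2) \<partial>M) = \<infinity>"
    and "summable (\<lambda>j. (\<psi> j)\<^sup>2)"
    and "iid M \<eta>"
    and "\<And>t. distributed M lborel (\<eta> t) std_normal_density"
    and "prob_space.indep_var M
           (\<Pi>\<^sub>M t\<in>UNIV. borel) (\<lambda>\<omega> t. Z t \<omega>)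
           (\<Pi>\<^sub>M t\<in>UNIV. borel) (\<lambda>\<omega> t. log_volatility \<psi> \<eta> t \<omega>)"
    and "normalizing_sequence M (Z 0) a"
  shows "weak_conv_m
           (\<lambda>n. distr M borel (\<lambda>\<omega>. inverse (a n) * (\<Sum>t=1..n. sv_process \<psi> \<eta> Z (int t) \<omega>)))
           (density lborel (normal_density 0 (sqrt (exp (2 * (\<Sum>j. (\<psi> j)\<^sup>2))))))"
proof -
  interpret prob_space M by fact
  have indepZ: "indep_vars (\<lambda>_. borel) Z UNIV" and identZ: "\<And>t. distr M borel (Z t) = distr M borel (Z 0)"
    using \<open>iid M Z\<close> by (auto simp: iid_def)
  have Zm[measurable]: "Z t \<in> borel_measurable M" for t using indepZ by (auto simp: indep_vars_def)
  interpret gaussian_noise M \<eta>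
    using \<open>iid M \<eta>\<close> assms(9) by unfold_locales (auto simp: iid_def)
  define \<mu> where "\<mu> = distr M borel (Z 0)"
  interpret \<mu>: square_tail_distribution \<mu>
    unfolding \<mu>_def using assms by (intro regularly_varying_square_tail) auto
  define K where "K = exp (2 * (\<Sum>j. (\<psi> j)\<^sup>2))"
  define s where "s n = inverse (a n)" for n
  have norming: "\<forall>\<^sub>F n in sequentially. s n \<noteq> 0 \<and> real n * truncated_second_moment \<mu> (s n) = 1"
    using normalizing_sequence_truncated_moment[OF \<open>prob_space M\<close> Zm assms(11)]
    unfolding \<mu>_def s_def by eventually_elim auto
  let ?L = "log_volatility \<psi> \<eta>"
  let ?V = "\<lambda>t \<omega>. exp (?L (int t) \<omega>)"
  have Vsq: "(?V t \<omega>)\<^sup>2 = exp (2 * ?L (int t) \<omega>)" for t \<omega>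
    by (simp add: exp_double)
  have product_limit: "(\<lambda>n. \<integral>\<omega>. (\<Prod>t=1..n. char \<mu> (u * ?V t \<omega> * s n)) \<partial>M) \<longlonglongrightarrow> exp (- of_real (u\<^sup>2 * K) / 2)" for u
  proof (rule \<mu>.expected_char_product_limit)
    show "distr M borel (?V t) = distr M borel (?V 0)" for t
    proof -
      have V: "distr M borel (?V t) = distr (distr M borel (?L (int t))) borel exp" for t
        by (subst distr_distr) (simp_all add: comp_def)
      show ?thesis unfolding V distr_log_volatility[of \<psi> "int _"] ..
    qed
    show "integrable M (\<lambda>\<omega>. (?V 0 \<omega>)\<^sup>2)"
      unfolding Vsq by (rule squared_volatility_approximation(1)[OF assms(7)])
    show "(\<lambda>n. \<integral>\<omega>. \<bar>(\<Sum>t=1..n. (?V t \<omega>)\<^sup>2) / real n - K\<bar> \<partial>M) \<longlonglongrightarrow> 0"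
      unfolding Vsq K_def by (rule squared_volatility_weak_law[OF assms(7)])
    show "filterlim s (at 0) sequentially" by (rule \<mu>.normalized_tendsto_0[OF norming])
    show "\<forall>\<^sub>F n in sequentially. real n * truncated_second_moment \<mu> (s n) = 1"
      using norming by eventually_elim simp
  qed (use \<open>prob_space M\<close> in \<open>auto simp: K_def\<close>)
  let ?S = "\<lambda>n \<omega>. inverse (a n) * (\<Sum>t=1..n. sv_process \<psi> \<eta> Z (int t) \<omega>)"
  have Sm[measurable]: "?S n \<in> borel_measurable M" for n
    unfolding sv_process_def by measurable
  have char_S: "char (distr M borel (?S n)) u = (\<integral>\<omega>. (\<Prod>t=1..n. char \<mu> (u * ?V t \<omega> * s n)) \<partial>M)" for n u
  proof -
    let ?g = "\<lambda>x. u * exp x * s n"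
    have inj: "inj_on int {1..n}" by (simp add: inj_on_def)
    have linear: "u * ?S n \<omega> = (\<Sum>t\<in>int ` {1..n}. ?g (?L t \<omega>) * Z t \<omega>)" for \<omega>
      unfolding sum.reindex[OF inj] comp_def sum_distrib_left
      by (intro sum.cong) (simp_all add: sv_process_def s_def)
    have "char (distr M borel (?S n)) u = (\<integral>\<omega>. iexp (\<Sum>t\<in>int ` {1..n}. ?g (?L t \<omega>) * Z t \<omega>) \<partial>M)"
      unfolding char_def linear[symmetric] by (rule integral_distr) measurable
    also have "\<dots> = (\<integral>\<omega>. (\<Prod>t\<in>int ` {1..n}. char \<mu> (?g (?L t \<omega>))) \<partial>M)"
      by (rule expectation_iexp_random_weights[OF indepZ identZ[folded \<mu>_def] assms(10)]) simp_all
    also have "\<dots> = (\<integral>\<omega>. (\<Prod>t=1..n. char \<mu> (u * ?V t \<omega> * s n)) \<partial>M)"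
      unfolding prod.reindex[OF inj] comp_def ..
    finally show ?thesis .
  qed
  have K: "0 < sqrt K" "(sqrt K)\<^sup>2 = K" by (simp_all add: K_def)
  show ?thesis
    unfolding K_def[symmetric]
  proof (rule levy_continuity)
    show "real_distribution (distr M borel (?S n))" for n by (rule real_distribution_distr) measurable
    show "real_distribution (density lborel (normal_density 0 (sqrt K)))"
      by (rule centered_normal_distribution(1)[OF K(1)])
    show "(\<lambda>n. char (distr M borel (?S n)) u) \<longlonglongrightarrow> char (density lborel (normal_density 0 (sqrt K))) u" for u
      unfolding centered_normal_distribution(2)[OF K(1)] K(2) char_S by (rule product_limit)
  qed
qed

end
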